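(* Let $I$ be a monomial ideal in $R=\Bbbk[x_1,\dots,x_N]$ and $X$ the full simplex on $\mathcal G(I)$, which with the labelling $\operatorname{lcm}$ is the $\mathbb Z^N$-graded complex supporting the Taylor resolution of $R/I$. Let $P$ be a poset, $f$ an $\operatorname{lcm}$-compatible $P$-grading of $X$, and $(>_p)_{p\in P}$ a family of total orderings of $\mathcal G(I)$. Assume $f(\sigma\setminus\operatorname{sb}_{>_p}(\sigma))=f(\sigma)$ for all $p\in P$ and all subsets $\sigma$ of $\mathcal G(I)$ with $f(\sigma)=p$. For each $p\in P$, let $A_p$ be the $f$-homogeneous acyclic matching obtained by applying the Barile-Macchia algorithm to the set $f^{-1}(p)$ with the total ordering $>_p$. Then $A=\bigcup_{p\in P}A_p$ is an $f$-homogeneous acyclic matching. Hence, it induces a graded free resolution $\mathcal F_A$ of $R/I$.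
   Context: $\Bbbk$ is a field, $\mathcal G(I)$ is the set of minimal monomial generators of $I$. Cells of $X$ are identified with subsets of $\mathcal G(I)$, ordered by inclusion; write $X^{( * )}$ for this poset. Monomials are identified with their exponent vectors in $\mathbb Z^N$ (partially ordered componentwise). An order-preserving map $f:X^{( * )}\to P$ is an $\operatorname{lcm}$-compatible $P$-grading if there is an order-preserving map $g:P\to\mathbb Z^N$ with $g\circ f=\operatorname{lcm}$. Let $G=(V,E)$ be the directed graph on all subsets of $\mathcal G(I)$ with edges $(\sigma,\sigma')$ whenever $\sigma'\subseteq\sigma$, $|\sigma'|=|\sigma|-1$; for $A\subseteq E$, $G^A$ is obtained by reversing the edges in $A$. $A$ is an $f$-homogeneous acyclic matching if every subset appears in at most one edge of $A$, $G^A$ has no directed cycle, and $f(\sigma)=f(\sigma')$ for all $(\sigma,\sigma')\in A$. Subsets in no edge of $A$ are critical. Induced complex. Let $[\sigma:\sigma']=\pm1$ be the simplicial boundary signs. For an edge $(\sigma,\sigma')$ of $G^A$ put $m(\sigma,\sigma')=-[\sigma':\sigma]$ if $(\sigma',\sigma)\in A$, and $[\sigma:\sigma']$ otherwise; a gradient path $\mathcal P$ is a directed path in $G^A$ and $m(\mathcal P)$ is the product of the $m$'s of its edges. $\mathcal F_A$ has $(\mathcal F_A)_r$ free on the critical subsets of cardinality $r$ and $$\partial_r^A(\sigma)=\sum_{\sigma'\subseteq\sigma,\,|\sigma'|=r-1}[\sigma:\sigma']\sum_{\sigma''\text{ critical},\,|\sigma''|=r-1}\ \sum_{\mathcal P:\sigma'\to\cdots\to\sigma''}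 m(\mathcal P)\frac{\operatorname{lcm}(\sigma)}{\operatorname{lcm}(\sigma'')}\sigma''.$$ (By a theorem of Batzies and Welker, any $f$-homogeneous acyclic matching for an $\operatorname{lcm}$-compatible grading $f$ induces a free resolution of $R/I$ in this way.) Algorithm. $m$ is a bridge of $\sigma$ if $m\in\sigma$ and $\operatorname{lcm}(\sigma\setminus m)=\operatorname{lcm}(\sigma)$; $\operatorname{sb}_{>_p}(\sigma)$ is the $>_p$-smallest bridge of $\sigma$, or $\emptyset$ if there is none ($\sigma\setminus\emptyset=\sigma$). Applying the Barile-Macchia algorithm to $f^{-1}(p)$ with $>_p$: start with $A_p=\emptyset$ and $\Omega=\{\sigma\in f^{-1}(p):|\sigma|\ge3\}$. (1) Pick $\sigma\in\Omega$ of maximal cardinality. (2) Replace $\Omega$ by $\Omega\setminus\{\sigma,\sigma\setminus\operatorname{sb}_{>_p}(\sigma)\}$; if $\operatorname{sb}_{>_p}(\sigma)\ne\emptyset$ add $(\sigma,\sigma\setminus\operatorname{sb}_{>_p}(\sigma))$ to $A_p$; if $\Omega\neq\emptyset$ return to (1). (3) Whenever two distinct edges of $A_p$ have the same target, remove the one whose source has the larger smallest bridge w.r.t. $>_p$. *)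

theory Defs
  imports Complex_Main "HOL-Library.Poly_Mapping"
begin

section \<open>Monomial ideals\<close>

text \<open>The variables are indexed by a finite type \<^typ>\<open>'n\<close>, so \<open>N = CARD('n)\<close>. The instance order
  \<open>\<le>\<close> that \<^theory>\<open>HOL-Library.Poly_Mapping\<close> puts on exponent vectors is lexicographic; divisibility
  is the componentwise order and therefore always goes through \<^const>\<open>Poly_Mapping.lookup\<close>.\<close>

type_synonym 'n monomial = "'n \<Rightarrow>\<^sub>0 nat"
type_synonym ('n, 'k) mpoly = "('n \<Rightarrow>\<^sub>0 nat) \<Rightarrow>\<^sub>0 'k"

definition mono_dvd :: "'n monomial \<Rightarrow> 'n monomial \<Rightarrow> bool" where
  "mono_dvd a b \<longleftrightarrow> (\<forall>i. Poly_Mapping.lookup a i \<le> Poly_Mapping.lookup b i)"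

definition mpow :: "'n monomial \<Rightarrow> ('n, 'k::comm_ring_1) mpoly" where
  "mpow a = Poly_Mapping.single a 1"

definition monomial_ideal :: "('n, 'k::comm_ring_1) mpoly set \<Rightarrow> bool" where
  "monomial_ideal I \<longleftrightarrow> (\<exists>M. I = module.span (*) (mpow ` M))"

definition mingens :: "('n, 'k::comm_ring_1) mpoly set \<Rightarrow> 'n monomial set" where
  "mingens I = {a. mpow a \<in> I \<and> (\<forall>b. mpow b \<in> I \<and> mono_dvd b a \<longrightarrow> b = a)}"

definition lcm_mono :: "'n::finite monomial set \<Rightarrow> 'n monomial" where
  "lcm_mono \<sigma> = Abs_poly_mapping (\<lambda>i. Max (insert 0 ((\<lambda>a. Poly_Mapping.lookup a i) ` \<sigma>)))"

text \<open>The embedding of exponent vectors into \<open>\<int>\<^sup>N\<close>, the latter carrying the componentwise order of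
  the function type.\<close>

definition expvec :: "'n monomial \<Rightarrow> 'n \<Rightarrow> int" where
  "expvec a = (\<lambda>i. int (Poly_Mapping.lookup a i))"


section \<open>Gradings and homogeneous acyclic matchings\<close>

text \<open>Throughout, \<open>S\<close> is the vertex set of the simplex; its cells are all subsets of \<open>S\<close>, including
  the empty one.\<close>

definition lcm_compatible :: "'n::finite monomial set \<Rightarrow> ('n monomial set \<Rightarrow> 'p::order) \<Rightarrow> bool" where
  "lcm_compatible S f \<longleftrightarrow> mono_on (Pow S) f \<and>
     (\<exists>g :: 'p \<Rightarrow> 'n \<Rightarrow> int. mono g \<and> (\<forall>\<sigma>\<subseteq>S. g (f \<sigma>) = expvec (lcm_mono \<sigma>)))"

definition cell_edges :: "'a set \<Rightarrow> 'a set rel" where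
  "cell_edges S = {(\<sigma>, \<sigma>'). \<sigma> \<subseteq> S \<and> \<sigma>' \<subseteq> \<sigma> \<and> card \<sigma> = card \<sigma>' + 1}"

definition reverse_edges :: "'a set \<Rightarrow> 'a set rel \<Rightarrow> 'a set rel" where
  "reverse_edges S A = (cell_edges S - A) \<union> A\<inverse>"

definition hom_acyclic_matching :: "'a set \<Rightarrow> ('a set \<Rightarrow> 'p) \<Rightarrow> 'a set rel \<Rightarrow> bool" where
  "hom_acyclic_matching S f A \<longleftrightarrow>
     A \<subseteq> cell_edges S \<and>
     (\<forall>\<sigma>. \<exists>\<^sub>\<le>\<^sub>1 e. e \<in> A \<and> (fst e = \<sigma> \<or> snd e = \<sigma>)) \<and>
     acyclic (reverse_edges S A) \<and>
     (\<forall>(\<sigma>, \<sigma>') \<in> A. f \<sigma> = f \<sigma>')"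

definition critical :: "'a set \<Rightarrow> 'a set rel \<Rightarrow> 'a set set" where
  "critical S A = {\<sigma>. \<sigma> \<subseteq> S \<and> \<sigma> \<notin> Field A}"


section \<open>The Barile--Macchia algorithm\<close>

text \<open>A total ordering is a reflexive relation \<open>r\<close>, where \<open>(a, b) \<in> r\<close> means that \<open>a\<close> is smaller than
  or equal to \<open>b\<close>.\<close>

definition bridges :: "'n::finite monomial set \<Rightarrow> 'n monomial set" where
  "bridges \<sigma> = {m \<in> \<sigma>. lcm_mono (\<sigma> - {m}) = lcm_mono \<sigma>}"

text \<open>The smallest bridge \<open>m\<close> is represented by the set \<open>{m}\<close>, so that \<open>\<sigma> - sb r \<sigma>\<close> is meaningful
  also when there is no bridge and \<open>sb r \<sigma>\<close> is empty.\<close>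

definition sb :: "'n::finite monomial rel \<Rightarrow> 'n monomial set \<Rightarrow> 'n monomial set" where
  "sb r \<sigma> = {m \<in> bridges \<sigma>. \<forall>m' \<in> bridges \<sigma>. (m, m') \<in> r}"

text \<open>Reachable states \<open>(\<Omega>, A)\<close> of the loop formed by the first two steps, started on a set \<open>C\<close> of
  cells. The choice of a cell of maximal cardinality is nondeterministic.\<close>

inductive bm_loop ::
  "'n::finite monomial rel \<Rightarrow> 'n monomial set set \<Rightarrow> 'n monomial set set \<Rightarrow> 'n monomial set rel \<Rightarrow> bool"
  for r C where
  start: "bm_loop r C {\<sigma> \<in> C. 3 \<le> card \<sigma>} {}"
| step: "bm_loop r C \<Omega> A \<Longrightarrow> \<sigma> \<in> \<Omega> \<Longrightarrow> (\<And>\<tau>. \<tau> \<in> \<Omega> \<Longrightarrow> card \<tau> \<le> card \<sigma>) \<Longrightarrow>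
    bm_loop r C (\<Omega> - {\<sigma>, \<sigma> - sb r \<sigma>})
      (if sb r \<sigma> \<noteq> {} then insert (\<sigma>, \<sigma> - sb r \<sigma>) A else A)"

text \<open>Third step: of several edges with the same target, only the one whose source has the smallest
  smallest bridge survives.\<close>

definition bm_prune :: "'n::finite monomial rel \<Rightarrow> 'n monomial set rel \<Rightarrow> 'n monomial set rel" where
  "bm_prune r A = {(\<sigma>, \<tau>) \<in> A.
     \<not> (\<exists>\<sigma>'. (\<sigma>', \<tau>) \<in> A \<and> \<sigma>' \<noteq> \<sigma> \<and>
          (\<exists>m \<in> sb r \<sigma>. \<exists>m' \<in> sb r \<sigma>'. m' \<noteq> m \<and> (m', m) \<in> r))}"

definition barile_macchia ::
  "'n::finite monomial rel \<Rightarrow> 'n monomial set set \<Rightarrow> 'n monomial set rel \<Rightarrow> bool" where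
  "barile_macchia r C A \<longleftrightarrow> (\<exists>A\<^sub>0. bm_loop r C {} A\<^sub>0 \<and> A = bm_prune r A\<^sub>0)"


section \<open>Graded free resolutions of \<open>R/I\<close>\<close>

text \<open>The free module on \<open>B\<close> consists of the finitely supported functions to \<open>R\<close> supported in \<open>B\<close>.\<close>

definition free_module :: "'b set \<Rightarrow> ('b \<Rightarrow>\<^sub>0 'r::comm_ring_1) set" where
  "free_module B = {x. Poly_Mapping.keys x \<subseteq> B}"

definition smul :: "'r::comm_ring_1 \<Rightarrow> ('b \<Rightarrow>\<^sub>0 'r) \<Rightarrow> ('b \<Rightarrow>\<^sub>0 'r)" where
  "smul c x = Poly_Mapping.map ((*) c) x"

definition homog_poly :: "('n \<Rightarrow> int) \<Rightarrow> ('n, 'k::comm_ring_1) mpoly \<Rightarrow> bool" where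
  "homog_poly d p \<longleftrightarrow> (\<forall>a \<in> Poly_Mapping.keys p. expvec a = d)"

text \<open>The basis element \<open>b\<close> of a graded free module sits in degree \<open>deg b\<close>.\<close>

definition homog_elem ::
  "('b \<Rightarrow> 'n \<Rightarrow> int) \<Rightarrow> ('n \<Rightarrow> int) \<Rightarrow> ('b \<Rightarrow>\<^sub>0 ('n, 'k::comm_ring_1) mpoly) \<Rightarrow> bool" where
  "homog_elem deg d x \<longleftrightarrow> (\<forall>b. homog_poly (\<lambda>i. d i - deg b i) (Poly_Mapping.lookup x b))"

text \<open>\<open>R/I\<close> is the set of cosets of \<open>I\<close>, with the induced operations.\<close>

definition coset :: "'r::comm_ring_1 set \<Rightarrow> 'r \<Rightarrow> 'r set" where
  "coset I p = {q. q - p \<in> I}"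

definition coset_add :: "'r::comm_ring_1 set \<Rightarrow> 'r set \<Rightarrow> 'r set \<Rightarrow> 'r set" where
  "coset_add I C D = (\<Union>p\<in>C. \<Union>q\<in>D. coset I (p + q))"

definition coset_smul :: "'r::comm_ring_1 set \<Rightarrow> 'r \<Rightarrow> 'r set \<Rightarrow> 'r set" where
  "coset_smul I c C = (\<Union>p\<in>C. coset I (c * p))"

text \<open>A \<open>\<int>\<^sup>N\<close>-graded free resolution
  \<open>\<dots> \<rightarrow> F\<^sub>2 \<rightarrow> F\<^sub>1 \<rightarrow> F\<^sub>0 \<rightarrow> R/I \<rightarrow> 0\<close>, with \<open>F\<^sub>r\<close> free on \<open>B r\<close>, with differentials
  \<open>d r : F\<^sub>r \<rightarrow> F\<^sub>r\<^sub>-\<^sub>1\<close> for \<open>r \<ge> 1\<close> (\<open>d 0\<close> is irrelevant), and with augmentation \<open>\<epsilon>\<close>.\<close>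

definition graded_free_resolution ::
  "('n, 'k::field) mpoly set \<Rightarrow> (nat \<Rightarrow> 'b set) \<Rightarrow> ('b \<Rightarrow> 'n \<Rightarrow> int) \<Rightarrow>
   (nat \<Rightarrow> ('b \<Rightarrow>\<^sub>0 ('n, 'k) mpoly) \<Rightarrow> ('b \<Rightarrow>\<^sub>0 ('n, 'k) mpoly)) \<Rightarrow> bool" where
  "graded_free_resolution I B deg d \<longleftrightarrow>
     (\<forall>r. d (Suc r) ` free_module (B (Suc r)) \<subseteq> free_module (B r) \<and>
        (\<forall>x \<in> free_module (B (Suc r)).
           (\<forall>y \<in> free_module (B (Suc r)). d (Suc r) (x + y) = d (Suc r) x + d (Suc r) y) \<and>
           (\<forall>c. d (Suc r) (smul c x) = smul c (d (Suc r) x)) \<and>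
           (\<forall>a. homog_elem deg a x \<longrightarrow> homog_elem deg a (d (Suc r) x)))) \<and>
     (\<forall>r. {x \<in> free_module (B (Suc r)). d (Suc r) x = 0} =
          d (Suc (Suc r)) ` free_module (B (Suc (Suc r)))) \<and>
     (\<exists>\<epsilon> :: ('b \<Rightarrow>\<^sub>0 ('n, 'k) mpoly) \<Rightarrow> ('n, 'k) mpoly set.
        \<epsilon> ` free_module (B 0) = range (coset I) \<and>
        (\<forall>x \<in> free_module (B 0).
           (\<forall>y \<in> free_module (B 0). \<epsilon> (x + y) = coset_add I (\<epsilon> x) (\<epsilon> y)) \<and>
           (\<forall>c. \<epsilon> (smul c x) = coset_smul I c (\<epsilon> x)) \<and>
           (\<forall>a. homog_elem deg a x \<longrightarrow> (\<exists>p. homog_poly a p \<and> \<epsilon> x = coset I p))) \<and>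
        {x \<in> free_module (B 0). \<epsilon> x = coset I 0} = d (Suc 0) ` free_module (B (Suc 0)))"


section \<open>The complex induced by a matching\<close>

text \<open>The simplicial sign \<open>[\<sigma> : \<sigma>']\<close> for \<open>\<sigma>' = \<sigma> - {m}\<close>, with respect to the orientation given by a
  total order \<open>v\<close> of the vertices: the exponent is the position of \<open>m\<close> in \<open>\<sigma>\<close>.\<close>

definition incidence :: "'a rel \<Rightarrow> 'a set \<Rightarrow> 'a set \<Rightarrow> int" where
  "incidence v \<sigma> \<sigma>' = (-1) ^ card {x \<in> \<sigma>'. (x, the_elem (\<sigma> - \<sigma>')) \<in> v}"

definition edge_weight :: "'a rel \<Rightarrow> 'a set rel \<Rightarrow> 'a set \<Rightarrow> 'a set \<Rightarrow> int" where
  "edge_weight v A \<sigma> \<sigma>' =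
     (if (\<sigma>', \<sigma>) \<in> A then - incidence v \<sigma>' \<sigma> else incidence v \<sigma> \<sigma>')"

text \<open>Gradient paths are given by their lists of vertices; the path without edges is included.\<close>

definition gradient_paths :: "'a set \<Rightarrow> 'a set rel \<Rightarrow> 'a set \<Rightarrow> 'a set \<Rightarrow> 'a set list set" where
  "gradient_paths S A \<sigma> \<tau> =
     {P. P \<noteq> [] \<and> hd P = \<sigma> \<and> last P = \<tau> \<and> successively (\<lambda>x y. (x, y) \<in> reverse_edges S A) P}"

definition path_weight :: "'a rel \<Rightarrow> 'a set rel \<Rightarrow> 'a set list \<Rightarrow> int" where
  "path_weight v A P = prod_list (map2 (edge_weight v A) P (tl P))"

definition critical_cells :: "'a set \<Rightarrow> 'a set rel \<Rightarrow> nat \<Rightarrow> 'a set set" where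
  "critical_cells S A r = {\<sigma> \<in> critical S A. card \<sigma> = r}"

text \<open>The subtraction of exponent vectors expresses \<open>lcm(\<sigma>)/lcm(\<sigma>'')\<close>. It is truncated, but the
  division is exact whenever there is a gradient path from a facet of \<open>\<sigma>\<close> to \<open>\<sigma>''\<close> and the matching
  preserves \<open>lcm\<close>.\<close>

definition morse_boundary ::
  "'n::finite monomial set \<Rightarrow> 'n monomial rel \<Rightarrow> 'n monomial set rel \<Rightarrow> nat \<Rightarrow> 'n monomial set \<Rightarrow>
   ('n monomial set \<Rightarrow>\<^sub>0 ('n, 'k::field) mpoly)" where
  "morse_boundary S v A r \<sigma> =
     (\<Sum>\<sigma>' | \<sigma>' \<subseteq> \<sigma> \<and> card \<sigma>' = r - 1.
        smul (of_int (incidence v \<sigma> \<sigma>'))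
          (\<Sum>\<sigma>'' \<in> critical_cells S A (r - 1).
             \<Sum>P \<in> gradient_paths S A \<sigma>' \<sigma>''.
               Poly_Mapping.single \<sigma>''
                 (of_int (path_weight v A P) * mpow (lcm_mono \<sigma> - lcm_mono \<sigma>''))))"

text \<open>The \<open>R\<close>-linear extension.\<close>

definition morse_differential ::
  "'n::finite monomial set \<Rightarrow> 'n monomial rel \<Rightarrow> 'n monomial set rel \<Rightarrow> nat \<Rightarrow>
   ('n monomial set \<Rightarrow>\<^sub>0 ('n, 'k::field) mpoly) \<Rightarrow> ('n monomial set \<Rightarrow>\<^sub>0 ('n, 'k) mpoly)" where
  "morse_differential S v A r x =
     (\<Sum>\<sigma> \<in> Poly_Mapping.keys x. smul (Poly_Mapping.lookup x \<sigma>) (morse_boundary S v A r \<sigma>))"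

end

theory Submission
  imports Defs
begin

text \<open>
  Two facts are combined: the union of the Barile--Macchia matchings is acyclic, and every
  homogeneous acyclic matching induces a resolution.

  \<^emph>\<open>Acyclicity.\<close> Write \<open>R\<close> for the Hasse diagram of the simplex with the matched edges reversed.
  Along an edge of \<open>R\<close> the value of \<open>f\<close> does not grow: it is constant on reversed edges, which are
  matched, and \<open>f\<close> is monotone on the others. So \<open>f\<close> is constant on a directed cycle, equal to \<open>p\<close>
  say, and with it the lcm, since \<open>lcm\<close> factors through \<open>f\<close>. The steps of a cycle alternate: it goes down
  from a cell \<open>\<sigma>\<close> to a facet and then up along a matched edge, which inserts the smallest bridge of the
  cell it reaches. Each vertex removed from such a \<open>\<sigma>\<close> is a bridge, because the lcm stays the same, and
  it is larger than the smallest bridge, because the edge from \<open>\<sigma>\<close> to \<open>\<sigma>\<close> without its smallest bridge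
  is reversed. Now let \<open>m\<close> be the least vertex that is inserted along the cycle. It has to
  be removed again, from a cell whose own smallest bridge, also inserted along the cycle, is then
  smaller than \<open>m\<close>: a contradiction (\<open>acyclic_if_smallest_removed\<close>).

  \<^emph>\<open>Resolution.\<close> Decompose the simplicial chains as critical, source and target chains. By
  acyclicity the block of the boundary map from sources to targets is triangular with entries \<open>\<plusminus>1\<close> on
  the diagonal, hence invertible (\<open>source_chain_determined\<close>, \<open>source_chain_exists\<close>). The chains \<open>u\<close> such
  that neither \<open>u\<close> nor its boundary has a target component form a subcomplex, and restriction to
  critical cells identifies this subcomplex with the critical chains. The differential
  transported along this identification is the Schur complement of the invertible block, and the
  signed count of gradient paths computes it (\<open>bd_critical\<close>). It squares to zero because the
  simplicial boundary does, and it is exact because a nonempty simplex is acyclic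
  (\<open>morse_bd_morse_bd\<close>, \<open>morse_complex_exact\<close>).

  To pass from chains over the field to modules over the polynomial ring, split a module element
  into its strands of fixed degree \<open>a\<close>. The matching preserves lcms, so in degree \<open>a\<close> the induced
  complex is the Morse complex of the full simplex on the generators dividing \<open>x\<^sup>a\<close>
  (\<open>strand_differential\<close>). This simplex is nonempty exactly if \<open>x\<^sup>a \<in> I\<close>, which gives both exactness in
  positive homological degree and the identification of the cokernel with \<open>R/I\<close>.
\<close>

section \<open>Monomials\<close>

abbreviation lk where "lk \<equiv> Poly_Mapping.lookup"

lemma mono_dvd_refl [simp]: "mono_dvd a a"
  by (simp add: mono_dvd_def)

lemma mono_dvd_trans: "mono_dvd a b \<Longrightarrow> mono_dvd b c \<Longrightarrow> mono_dvd a c"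
  unfolding mono_dvd_def by (meson order_trans)

lemma mono_dvd_add: "mono_dvd a (b + a)"
  by (simp add: mono_dvd_def lookup_add)

text \<open>Subtraction of exponent vectors is truncated; divisibility makes it exact.\<close>

lemma mono_dvd_diff_add: "mono_dvd a b \<Longrightarrow> b - a + a = b"
  by (rule poly_mapping_eqI) (simp add: mono_dvd_def lookup_add lookup_minus)

lemma expvec_inject: "expvec a = expvec b \<longleftrightarrow> a = b"
  by (auto simp: expvec_def fun_eq_iff intro: poly_mapping_eqI)

lemma expvec_add: "expvec (a + b) = (\<lambda>i. expvec a i + expvec b i)"
  by (simp add: expvec_def lookup_add)

lemma lookup_lcm_mono:
  "lk (lcm_mono \<sigma>) i = Max (insert 0 ((\<lambda>a. lk a i) ` \<sigma>))"
  unfolding lcm_mono_def by (subst lookup_Abs_poly_mapping) (auto intro: finite_subset[OF _ finite])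

lemma lcm_mono_dvd_iff:
  assumes "finite \<sigma>" shows "mono_dvd (lcm_mono \<sigma>) a \<longleftrightarrow> (\<forall>m\<in>\<sigma>. mono_dvd m a)"
  using assms by (auto simp: mono_dvd_def lookup_lcm_mono)

lemma lcm_mono_empty [simp]: "lcm_mono {} = 0"
  by (rule poly_mapping_eqI) (simp add: lookup_lcm_mono)

text \<open>The differential multiplies by integers and monomials only, so with this rule its coefficients can
  be read off.\<close>

lemma lookup_mult_mpow:
  fixes p :: "('n, 'k::comm_ring_1) mpoly"
  shows "lk (p * mpow b) a = (if mono_dvd b a then lk p (a - b) else 0)"
proof -
  have "(\<Sum>q. lk (mpow b) q when a = l + q) = ((1 :: 'k) when a = l + b)" for l
  proof -
    have *: "(\<lambda>q. lk (mpow b) q when a = l + q) = (\<lambda>q. ((1 :: 'k) when a = l + b) when q = b)"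
      by (auto simp: fun_eq_iff mpow_def lookup_single when_def)
    show ?thesis unfolding * by (rule Sum_any_when_equal)
  qed
  hence "lk (p * mpow b) a = (\<Sum>l. lk p l when a = l + b)"
    by (simp add: lookup_mult mult_when)
  also have "\<dots> = (if mono_dvd b a then lk p (a - b) else 0)"
  proof (cases "mono_dvd b a")
    case True
    hence "a = l + b \<longleftrightarrow> l = a - b" for l
      using mono_dvd_diff_add[OF True] by (metis add_diff_cancel_right')
    thus ?thesis using True by simp
  next
    case False
    hence "a \<noteq> l + b" for l using mono_dvd_add by metis
    thus ?thesis using False by simp
  qed
  finally show ?thesis .
qed

lemma lookup_of_int_mult: "lk (of_int n * p) a = of_int n * lk (p :: ('n, 'k::comm_ring_1) mpoly) a"
proof -
  have "of_int n * p = Poly_Mapping.map ((*) (of_int n)) p"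
    unfolding mult_map_scale_conv_mult by simp
  thus ?thesis by (simp add: Poly_Mapping.map.rep_eq when_def)
qed

section \<open>Free modules and cosets\<close>

lemma lookup_smul [simp]: "lk (smul c x) b = c * lk x b"
  by (simp add: smul_def Poly_Mapping.map.rep_eq when_def)

lemma lookup_sum_smul: "lk (\<Sum>i\<in>X. smul (c i) (h i)) \<tau> = (\<Sum>i\<in>X. c i * lk (h i) \<tau>)"
  by (simp add: lookup_sum)

lemma free_moduleD: "x \<in> free_module K \<Longrightarrow> \<sigma> \<notin> K \<Longrightarrow> lk x \<sigma> = 0"
  by (auto simp: free_module_def in_keys_iff)

lemma free_module_add:
  "x \<in> free_module K \<Longrightarrow> y \<in> free_module K \<Longrightarrow> x + y \<in> free_module K"
  using keys_add[of x y] by (auto simp: free_module_def)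

lemma free_module_smul:
  assumes "x \<in> free_module K" shows "smul c x \<in> free_module K"
proof -
  have "lk x t = 0 \<Longrightarrow> lk (smul c x) t = 0" for t by simp
  thus ?thesis using assms unfolding free_module_def in_keys_iff subset_iff by blast
qed

text \<open>The ambient ring as a module over itself, so that ideals are its submodules.\<close>

lemma module_mult: "module ((*) :: 'r::comm_ring_1 \<Rightarrow> 'r \<Rightarrow> 'r)"
  by unfold_locales (simp_all add: algebra_simps)

lemma coset_eq_iff:
  fixes I :: "'r::comm_ring_1 set"
  assumes "module.subspace (*) I"
  shows "coset I p = coset I q \<longleftrightarrow> p - q \<in> I"
proof -
  interpret module "(*) :: 'r \<Rightarrow> _" by (rule module_mult)
  show ?thesis
  proof
    assume "coset I p = coset I q"
    moreover have "p \<in> coset I p" using subspace_0[OF assms] by (simp add: coset_def)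
    ultimately show "p - q \<in> I" by (auto simp: coset_def)
  next
    assume pq: "p - q \<in> I"
    show "coset I p = coset I q"
      unfolding coset_def
      using subspace_add[OF assms, of _ "p - q"] subspace_diff[OF assms, of _ "p - q"] pq by fastforce
  qed
qed

lemma coset_add_coset:
  fixes I :: "'r::comm_ring_1 set"
  assumes I: "module.subspace (*) I"
  shows "coset_add I (coset I p) (coset I q) = coset I (p + q)"
proof -
  interpret module "(*) :: 'r \<Rightarrow> _" by (rule module_mult)
  have "coset I (p' + q') = coset I (p + q)" if "p' \<in> coset I p" "q' \<in> coset I q" for p' q'
    using subspace_add[OF I, of "p' - p" "q' - q"] that
    unfolding coset_eq_iff[OF I] by (simp add: coset_def algebra_simps)
  hence "coset_add I (coset I p) (coset I q) = (\<Union>p'\<in>coset I p. \<Union>q'\<in>coset I q. coset I (p + q))"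
    unfolding coset_add_def by (intro SUP_cong refl)
  moreover have "p \<in> coset I p" "q \<in> coset I q" using subspace_0[OF I] by (simp_all add: coset_def)
  hence "coset I p \<noteq> {}" "coset I q \<noteq> {}" by blast+
  ultimately show ?thesis by simp
qed

lemma coset_smul_coset:
  fixes I :: "'r::comm_ring_1 set"
  assumes I: "module.subspace (*) I"
  shows "coset_smul I c (coset I p) = coset I (c * p)"
proof -
  interpret module "(*) :: 'r \<Rightarrow> _" by (rule module_mult)
  have "coset I (c * p') = coset I (c * p)" if "p' \<in> coset I p" for p'
    using subspace_scale[OF I, of "p' - p" c] that
    unfolding coset_eq_iff[OF I] by (simp add: coset_def algebra_simps)
  hence "coset_smul I c (coset I p) = (\<Union>p'\<in>coset I p. coset I (c * p))"
    unfolding coset_smul_def by (intro SUP_cong refl)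
  moreover have "p \<in> coset I p" using subspace_0[OF I] by (simp add: coset_def)
  hence "coset I p \<noteq> {}" by blast
  ultimately show ?thesis by simp
qed

section \<open>Minimal generators\<close>

lemma monotone_subsequence_nat:
  fixes u :: "nat \<Rightarrow> nat"
  obtains g where "strict_mono g" "incseq (\<lambda>n. u (g n))"
proof -
  obtain f where f: "strict_mono f" "monoseq (\<lambda>n. u (f n))" using seq_monosub by blast
  show thesis
  proof (cases "incseq (\<lambda>n. u (f n))")
    case False
    hence dec: "\<And>m n. m \<le> n \<Longrightarrow> u (f n) \<le> u (f m)"
      using f(2) by (auto simp: monoseq_def mono_def)
    obtain N where N: "\<And>n. u (f N) \<le> u (f n)"
      using ex_has_least_nat[of "\<lambda>_. True" 0 "\<lambda>n. u (f n)"] by auto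
    \<comment> \<open>A decreasing sequence of naturals is constant from the position of its minimum onwards.\<close>
    have const: "u (f (n + N)) = u (f N)" for n using N dec[of N "n + N"] by (simp add: le_antisym)
    show thesis
    proof (rule that[of "\<lambda>n. f (n + N)"])
      show "strict_mono (\<lambda>n. f (n + N))" using f(1) by (simp add: strict_mono_def)
    qed (simp add: const mono_def)
  qed (use that f(1) in blast)
qed

text \<open>Coordinates are treated one at a time: passing to a further subsequence keeps the coordinates that
  are already monotone.\<close>

lemma monotone_subsequence_coordinates:
  fixes u :: "nat \<Rightarrow> 'i \<Rightarrow> nat"
  assumes "finite F"
  shows "\<exists>g. strict_mono g \<and> (\<forall>i\<in>F. incseq (\<lambda>n. u (g n) i))"
  using assms
proof (induction F)
  case empty show ?case using strict_mono_id by auto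
next
  case (insert i F)
  then obtain g where g: "strict_mono g" "\<forall>i\<in>F. incseq (\<lambda>n. u (g n) i)" by auto
  obtain h where h: "strict_mono h" "incseq (\<lambda>n. u (g (h n)) i)"
    using monotone_subsequence_nat[of "\<lambda>n. u (g n) i"] by blast
  have "strict_mono (\<lambda>n. g (h n))" using g(1) h(1) by (simp add: strict_mono_def)
  moreover have "incseq (\<lambda>n. u (g (h n)) j)" if "j \<in> F" for j
    using g(2) that h(1) by (auto simp: mono_def strict_mono_less_eq)
  ultimately show ?case using h(2) by (intro exI[of _ "\<lambda>n. g (h n)"]) auto
qed

text \<open>Dickson's lemma. An infinite antichain would contain a sequence of distinct elements, and a
  subsequence that is monotone in every coordinate has comparable members.\<close>

lemma antichain_finite:
  fixes M :: "'n::finite monomial set"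
  assumes anti: "\<And>a b. a \<in> M \<Longrightarrow> b \<in> M \<Longrightarrow> mono_dvd a b \<Longrightarrow> a = b"
  shows "finite M"
proof (rule ccontr)
  assume "infinite M"
  then obtain u :: "nat \<Rightarrow> _" where u: "inj u" "range u \<subseteq> M" using infinite_countable_subset by blast
  obtain g where g: "strict_mono g" "\<forall>i\<in>UNIV. incseq (\<lambda>n. lk (u (g n)) i)"
    using monotone_subsequence_coordinates[of UNIV "\<lambda>n. lk (u n)"] by auto
  have "mono_dvd (u (g 0)) (u (g 1))" using g(2) by (auto simp: mono_dvd_def mono_def)
  moreover have "u (g 0) \<in> M" "u (g 1) \<in> M" using u(2) by auto
  ultimately have "u (g 0) = u (g 1)" using anti by blast
  hence "g 0 = g 1" using u(1) by (auto dest: injD)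
  thus False using g(1) by (simp add: strict_mono_eq)
qed

lemma finite_mingens: "finite (mingens (I :: ('n::finite, 'k::comm_ring_1) mpoly set))"
  by (rule antichain_finite) (auto simp: mingens_def)

text \<open>Among the monomials of the ideal that divide \<open>a\<close>, one of least total degree is minimal.\<close>

lemma mingens_dvd:
  fixes I :: "('n::finite, 'k::comm_ring_1) mpoly set"
  assumes "mpow a \<in> I" obtains m where "m \<in> mingens I" "mono_dvd m a"
proof -
  let ?P = "\<lambda>b. mpow b \<in> I \<and> mono_dvd b a" and ?deg = "\<lambda>b :: 'n monomial. \<Sum>i\<in>UNIV. lk b i"
  obtain m where m: "?P m" "\<And>b. ?P b \<Longrightarrow> ?deg m \<le> ?deg b"
    using ex_has_least_nat[of ?P a ?deg] assms by auto
  have "b = m" if b: "mpow b \<in> I" "mono_dvd b m" for b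
  proof (rule ccontr)
    assume "b \<noteq> m"
    then obtain i where "lk b i \<noteq> lk m i" by (auto intro: poly_mapping_eqI)
    hence "lk b i < lk m i" using b(2) by (simp add: mono_dvd_def order_le_neq_trans)
    hence "?deg b < ?deg m" using b(2)
      by (intro sum_strict_mono_ex1) (auto simp: mono_dvd_def)
    moreover have "?P b" using b m(1) mono_dvd_trans by blast
    ultimately show False using m(2) by fastforce
  qed
  thus thesis using that m(1) by (auto simp: mingens_def)
qed

text \<open>Membership in a monomial ideal is decided monomial by monomial: the polynomials all of whose
  monomials are multiples of minimal generators form a submodule that contains the generators.\<close>

lemma monomial_ideal_iff_keys:
  fixes I :: "('n::finite, 'k::comm_ring_1) mpoly set"
  assumes "monomial_ideal I"
  shows "p \<in> I \<longleftrightarrow> (\<forall>a\<in>Poly_Mapping.keys p. \<exists>m\<in>mingens I. mono_dvd m a)" (is "_ \<longleftrightarrow> ?K p")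
proof
  interpret module "(*) :: ('n, 'k) mpoly \<Rightarrow> _" by (rule module_mult)
  obtain M where M: "I = span (mpow ` M)" using assms unfolding monomial_ideal_def by blast
  have mult_mpow: "p * mpow m \<in> I" if "mpow m \<in> I" for p m
    using that unfolding M by (rule span_scale)
  {
    have "subspace {p. ?K p}"
      unfolding subspace_def
    proof (intro conjI ballI allI)
      show "0 \<in> {p. ?K p}" by simp
      show "p + q \<in> {p. ?K p}" if "p \<in> {p. ?K p}" "q \<in> {p. ?K p}" for p q
        using that keys_add[of p q] by blast
      show "c * p \<in> {p. ?K p}" if p: "p \<in> {p. ?K p}" for c p
      proof (intro CollectI ballI)
        fix a assume "a \<in> Poly_Mapping.keys (c * p)"
        then obtain b b' where *: "a = b + b'" "b' \<in> Poly_Mapping.keys p" using keys_mult[of c p] by blast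
        then obtain m where "m \<in> mingens I" "mono_dvd m b'" using p by blast
        thus "\<exists>m\<in>mingens I. mono_dvd m a" using * mono_dvd_add mono_dvd_trans by blast
      qed
    qed
    moreover have "mpow ` M \<subseteq> {p. ?K p}"
    proof (intro subsetI CollectI ballI)
      fix p a assume "p \<in> mpow ` M" and a: "a \<in> Poly_Mapping.keys p"
      then obtain b where b: "b \<in> M" "p = mpow b" by blast
      hence "a = b" using a by (simp add: mpow_def)
      moreover have "(mpow b :: ('n, 'k) mpoly) \<in> I" using b(1) span_base unfolding M by blast
      ultimately show "\<exists>m\<in>mingens I. mono_dvd m a" using mingens_dvd by metis
    qed
    ultimately show "p \<in> I \<Longrightarrow> ?K p" using span_minimal[of "mpow ` M" "{p. ?K p}"] M by blast
  }
  assume K: "?K p"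
  have "p = (\<Sum>a\<in>Poly_Mapping.keys p. Poly_Mapping.single a (lk p a))"
    by (rule poly_mapping_eqI) (simp add: lookup_sum lookup_single when_def in_keys_iff)
  moreover have "Poly_Mapping.single a (lk p a) \<in> I" if "a \<in> Poly_Mapping.keys p" for a
  proof -
    obtain m where m: "m \<in> mingens I" "mono_dvd m a" using K \<open>a \<in> _\<close> by blast
    have "Poly_Mapping.single a (lk p a) = Poly_Mapping.single (a - m) (lk p a) * mpow m"
      by (simp add: mpow_def mult_single mono_dvd_diff_add[OF m(2)])
    moreover have "mpow m \<in> I" using m(1) by (simp add: mingens_def)
    ultimately show ?thesis using mult_mpow by metis
  qed
  ultimately show "p \<in> I" using span_sum[of "Poly_Mapping.keys p" _ "mpow ` M"] M by metis
qed

section \<open>Signed chains on a simplex\<close>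

text \<open>The only property of a vertex order that the signs depend on. It is inherited by subsets of
  the vertex set, while a relation that is a linear order on a set is not a linear order on a proper
  subset.\<close>

definition oriented :: "'a set \<Rightarrow> 'a rel \<Rightarrow> bool" where
  "oriented V v \<longleftrightarrow> (\<forall>x\<in>V. \<forall>y\<in>V. x \<noteq> y \<longrightarrow> (x, y) \<in> v \<longleftrightarrow> (y, x) \<notin> v)"

lemma linear_order_oriented:
  assumes "linear_order_on S v" "V \<subseteq> S" shows "oriented V v"
  using assms
  unfolding oriented_def linear_order_on_def partial_order_on_def antisym_def total_on_def
  by blast

definition vsign :: "'a rel \<Rightarrow> 'a \<Rightarrow> 'a set \<Rightarrow> int" where
  "vsign v x \<tau> = (-1) ^ card {y \<in> \<tau>. (y, x) \<in> v}"

lemma vsign_square [simp]: "vsign v x \<tau> * vsign v x \<tau> = 1"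
  by (simp add: vsign_def flip: power_add)

lemma incidence_remove: "x \<in> \<sigma> \<Longrightarrow> incidence v \<sigma> (\<sigma> - {x}) = vsign v x (\<sigma> - {x})"
proof -
  assume "x \<in> \<sigma>"
  hence "\<sigma> - (\<sigma> - {x}) = {x}" by auto
  thus ?thesis by (simp add: incidence_def vsign_def)
qed

lemma vsign_insert:
  assumes "finite \<rho>" "y \<notin> \<rho>"
  shows "vsign v x (insert y \<rho>) = (if (y, x) \<in> v then - vsign v x \<rho> else vsign v x \<rho>)"
proof -
  have "{z \<in> insert y \<rho>. (z, x) \<in> v} =
      (if (y, x) \<in> v then insert y {z \<in> \<rho>. (z, x) \<in> v} else {z \<in> \<rho>. (z, x) \<in> v})"
    by auto
  thus ?thesis using assms by (simp add: vsign_def)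
qed

text \<open>Exactly one of \<open>x\<close>, \<open>y\<close> precedes the other, so exactly one of the two signs with respect to \<open>\<rho>\<close>
  changes when the other vertex is inserted. Both \<open>\<partial>\<partial> = 0\<close> and the cone homotopy rest on this identity.\<close>

lemma vsign_anticommute:
  assumes "oriented V v" "finite \<rho>" "x \<in> V - \<rho>" "y \<in> V - \<rho>" "x \<noteq> y"
  shows "vsign v y (insert x \<rho>) * vsign v x \<rho> = - (vsign v x (insert y \<rho>) * vsign v y \<rho>)"
proof -
  have "(x, y) \<in> v \<longleftrightarrow> (y, x) \<notin> v"
    using assms unfolding oriented_def by blast
  thus ?thesis using assms by (cases "(x, y) \<in> v") (simp_all add: vsign_insert mult.commute)
qed

text \<open>The simplicial boundary of the chain \<open>c\<close>, written as a function of the facet: the coefficient at \<open>\<tau>\<close>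
  collects the cofaces of \<open>\<tau>\<close>. The empty cell belongs to the complex, so this is the augmented
  chain complex, with all dimensions taken together.\<close>

definition bd :: "'a set \<Rightarrow> 'a rel \<Rightarrow> ('a set \<Rightarrow> 'k::comm_ring_1) \<Rightarrow> 'a set \<Rightarrow> 'k" where
  "bd V v c \<tau> = (\<Sum>x\<in>V - \<tau>. of_int (vsign v x \<tau>) * c (insert x \<tau>))"

definition chain_on :: "'a set set \<Rightarrow> ('a set \<Rightarrow> 'k::zero) \<Rightarrow> bool" where
  "chain_on K c \<longleftrightarrow> (\<forall>\<sigma>. c \<sigma> \<noteq> 0 \<longrightarrow> \<sigma> \<in> K)"

lemma chain_onD: "chain_on K c \<Longrightarrow> \<sigma> \<notin> K \<Longrightarrow> c \<sigma> = 0"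
  by (auto simp: chain_on_def)

lemma chain_on_bd:
  assumes "chain_on (Pow V) c" shows "chain_on (Pow V) (bd V v c)"
proof -
  have "bd V v c \<tau> = 0" if "\<not> \<tau> \<subseteq> V" for \<tau>
    unfolding bd_def using that
  proof (intro sum.neutral ballI)
    fix x
    have "\<not> insert x \<tau> \<subseteq> V" using that by blast
    thus "of_int (vsign v x \<tau>) * c (insert x \<tau>) = 0"
      using chain_onD[OF assms] by simp
  qed
  thus ?thesis by (auto simp: chain_on_def)
qed

lemma bd_diff: "bd V v (\<lambda>\<sigma>. b \<sigma> - c \<sigma>) \<tau> = bd V v b \<tau> - bd V v c \<tau>"
  by (simp add: bd_def algebra_simps sum_subtractf)

text \<open>In characteristic 2 antisymmetry of a sum does not show that it vanishes, so the terms are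
  cancelled in pairs, with the vertex order selecting one member of each pair.\<close>

lemma sum_antisymmetric_pairs:
  fixes g :: "'a \<Rightarrow> 'a \<Rightarrow> 'k::comm_ring_1"
  assumes "finite W" "oriented W v"
    and anti: "\<And>x y. x \<in> W \<Longrightarrow> y \<in> W \<Longrightarrow> x \<noteq> y \<Longrightarrow> g x y = - g y x"
  shows "(\<Sum>x\<in>W. \<Sum>y\<in>W - {x}. g x y) = 0"
proof -
  let ?L = "{(x, y) \<in> W \<times> W. x \<noteq> y \<and> (x, y) \<in> v}"
  let ?G = "{(x, y) \<in> W \<times> W. x \<noteq> y \<and> (x, y) \<notin> v}"
  have fin: "finite ?L" "finite ?G"
    using assms(1) by (auto intro: finite_subset[of _ "W \<times> W"])
  have "(\<Sum>x\<in>W. \<Sum>y\<in>W - {x}. g x y) = (\<Sum>(x, y)\<in>?L \<union> ?G. g x y)"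
    by (subst sum.Sigma) (use assms(1) in \<open>auto intro!: sum.cong\<close>)
  also have "\<dots> = (\<Sum>(x, y)\<in>?L. g x y) + (\<Sum>(x, y)\<in>?G. g x y)"
    by (rule sum.union_disjoint) (use fin in auto)
  also have "(\<Sum>(x, y)\<in>?G. g x y) = (\<Sum>(x, y)\<in>?L. g y x)"
  proof -
    have "bij_betw prod.swap ?L ?G"
      by (rule bij_betw_byWitness[where f' = prod.swap])
        (use assms(2) in \<open>unfold oriented_def, auto\<close>)
    from sum.reindex_bij_betw[OF this, of "\<lambda>(x, y). g x y"] show ?thesis
      by (simp add: case_prod_beta)
  qed
  also have "\<dots> = (\<Sum>(x, y)\<in>?L. - g x y)"
    by (rule sum.cong) (use anti in \<open>auto simp: eq_neg_iff_add_eq_0\<close>)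
  also have "\<dots> = - (\<Sum>(x, y)\<in>?L. g x y)"
    by (simp add: case_prod_beta sum_negf)
  finally show ?thesis by simp
qed

lemma bd_bd:
  fixes c :: "'a set \<Rightarrow> 'k::comm_ring_1"
  assumes "finite V" "oriented V v" "\<rho> \<subseteq> V"
  shows "bd V v (bd V v c) \<rho> = 0"
proof -
  define g where
    "g x y = of_int (vsign v x \<rho> * vsign v y (insert x \<rho>)) * c (insert y (insert x \<rho>))" for x y
  have fin: "finite \<rho>" using assms finite_subset by auto
  have ori: "oriented (V - \<rho>) v" using assms(2) unfolding oriented_def by blast
  have "bd V v (bd V v c) \<rho> = (\<Sum>x\<in>V - \<rho>. \<Sum>y\<in>V - \<rho> - {x}. g x y)"
    unfolding bd_def g_def sum_distrib_left
    by (intro sum.cong) (auto simp: mult.assoc)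
  also have "\<dots> = 0"
  proof (rule sum_antisymmetric_pairs[OF _ ori])
    show "g x y = - g y x" if "x \<in> V - \<rho>" "y \<in> V - \<rho>" "x \<noteq> y" for x y
      using vsign_anticommute[OF assms(2) fin that]
      by (simp add: g_def insert_commute mult.commute)
  qed (use assms(1) in auto)
  finally show ?thesis .
qed

text \<open>A nonempty simplex is a cone over any of its vertices \<open>a\<close>: the chain \<open>e\<close> that joins \<open>a\<close> to the
  part of the cycle \<open>c\<close> away from \<open>a\<close> has boundary \<open>c\<close>. On cells that contain \<open>a\<close> this uses that \<open>c\<close> is a
  cycle.\<close>

lemma cone_exact:
  fixes c :: "'a set \<Rightarrow> 'k::comm_ring_1"
  assumes V: "finite V" "oriented V v" "V \<noteq> {}"
    and c: "chain_on (Pow V) c" and cycle: "\<And>\<tau>. \<tau> \<subseteq> V \<Longrightarrow> bd V v c \<tau> = 0"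
  obtains e where "chain_on (Pow V) e" "\<And>\<tau>. \<tau> \<subseteq> V \<Longrightarrow> bd V v e \<tau> = c \<tau>"
proof -
  obtain a where a: "a \<in> V" using V(3) by auto
  define e where
    "e \<sigma> = (if a \<in> \<sigma> then of_int (vsign v a (\<sigma> - {a})) * c (\<sigma> - {a}) else 0)" for \<sigma>
  have "chain_on (Pow V) e"
    unfolding chain_on_def
  proof (intro allI impI)
    fix \<sigma> assume "e \<sigma> \<noteq> 0"
    hence "c (\<sigma> - {a}) \<noteq> 0" by (auto simp: e_def split: if_splits)
    hence "\<sigma> - {a} \<subseteq> V" using c by (auto simp: chain_on_def)
    thus "\<sigma> \<in> Pow V" using a by blast
  qed
  moreover have "bd V v e \<tau> = c \<tau>" if \<tau>: "\<tau> \<subseteq> V" for \<tau>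
  proof (cases "a \<in> \<tau>")
    case False
    have "bd V v e \<tau> = (\<Sum>x\<in>{a}. of_int (vsign v x \<tau>) * e (insert x \<tau>))"
      unfolding bd_def
      by (rule sum.mono_neutral_right) (use V a False in \<open>auto simp: e_def\<close>)
    also have "\<dots> = of_int (vsign v a \<tau> * vsign v a \<tau>) * c \<tau>"
      using False by (simp add: e_def mult.assoc del: vsign_square)
    finally show ?thesis by simp
  next
    case True
    define \<rho> where "\<rho> = \<tau> - {a}"
    have \<rho>: "\<tau> = insert a \<rho>" "a \<notin> \<rho>" "\<rho> \<subseteq> V" "finite \<rho>"
      using True \<tau> V(1) finite_subset by (auto simp: \<rho>_def)
    \<comment> \<open>The cycle condition at \<open>\<rho> = \<tau> - {a}\<close> expresses \<open>c \<tau>\<close> through the cofaces of \<open>\<rho>\<close> away from \<open>a\<close>.\<close>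
    have star: "V - \<rho> = insert a (V - \<tau>)" using \<rho>(1,2) a by blast
    have split: "bd V v c \<rho> = of_int (vsign v a \<rho>) * c \<tau> +
        (\<Sum>x\<in>V - \<tau>. of_int (vsign v x \<rho>) * c (insert x \<rho>))"
      unfolding bd_def star using V(1) True by (subst sum.insert) (simp_all flip: \<rho>(1))
    have "bd V v e \<tau> = (\<Sum>x\<in>V - \<tau>. of_int (vsign v x (insert a \<rho>) * vsign v a (insert x \<rho>)) *
        c (insert x \<rho>))"
      unfolding bd_def
    proof (rule sum.cong)
      fix x assume x: "x \<in> V - \<tau>"
      hence "insert x \<tau> - {a} = insert x \<rho>" using \<rho>(1,2) True by blast
      thus "of_int (vsign v x \<tau>) * e (insert x \<tau>) =
          of_int (vsign v x (insert a \<rho>) * vsign v a (insert x \<rho>)) * c (insert x \<rho>)"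
        using True by (simp add: e_def mult.assoc flip: \<rho>(1))
    qed auto
    also have "\<dots> = (\<Sum>x\<in>V - \<tau>. of_int (- (vsign v a \<rho> * vsign v x \<rho>)) * c (insert x \<rho>))"
    proof (rule sum.cong)
      fix x assume x: "x \<in> V - \<tau>"
      have "vsign v x (insert a \<rho>) * vsign v a \<rho> = - (vsign v a (insert x \<rho>) * vsign v x \<rho>)"
        by (rule vsign_anticommute[OF V(2) \<rho>(4)]) (use x \<rho> a in auto)
      hence "vsign v x (insert a \<rho>) * (vsign v a \<rho> * vsign v a \<rho>) =
          - (vsign v a \<rho> * vsign v x \<rho> * vsign v a (insert x \<rho>))"
        by (simp add: algebra_simps del: vsign_square)
      hence "vsign v x (insert a \<rho>) = - (vsign v a \<rho> * vsign v x \<rho> * vsign v a (insert x \<rho>))"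
        by simp
      hence "vsign v x (insert a \<rho>) * vsign v a (insert x \<rho>) = 
         - (vsign v a \<rho> * vsign v x \<rho> * (vsign v a (insert x \<rho>) * vsign v a (insert x \<rho>)))"
        by (simp del: vsign_square)
      thus "of_int (vsign v x (insert a \<rho>) * vsign v a (insert x \<rho>)) * c (insert x \<rho>) =
          of_int (- (vsign v a \<rho> * vsign v x \<rho>)) * c (insert x \<rho>)" by simp
    qed auto
    also have "\<dots> = - of_int (vsign v a \<rho>) *
        (\<Sum>x\<in>V - \<tau>. of_int (vsign v x \<rho>) * c (insert x \<rho>))"
      by (simp add: sum_distrib_left sum_negf mult.assoc)
    also have "\<dots> = of_int (vsign v a \<rho> * vsign v a \<rho>) * c \<tau>"
    proof -
      have "(\<Sum>x\<in>V - \<tau>. of_int (vsign v x \<rho>) * c (insert x \<rho>)) = - (of_int (vsign v a \<rho>) * c \<tau>)"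
        using cycle[OF \<rho>(3)] split by (simp add: eq_neg_iff_add_eq_0 add.commute)
      thus ?thesis by (simp add: mult.assoc del: vsign_square)
    qed
    finally show ?thesis by simp
  qed
  ultimately show thesis by (rule that)
qed

section \<open>Acyclic matchings and gradient paths\<close>

text \<open>Acyclicity is kept separate from the other conditions, because the bound on heights below is itself
  used to establish acyclicity.\<close>

locale matching =
  fixes S :: "'a set" and A :: "'a set rel"
  assumes finite_vertices: "finite S"
    and edges: "A \<subseteq> cell_edges S"
    and matched_once: "\<exists>\<^sub>\<le>\<^sub>1 e. e \<in> A \<and> (fst e = \<sigma> \<or> snd e = \<sigma>)"
begin

abbreviation R where "R \<equiv> reverse_edges S A"

lemma edgeD:
  assumes "(\<sigma>, \<tau>) \<in> A"
  shows "\<sigma> \<subseteq> S" "\<tau> \<subseteq> \<sigma>" "card \<sigma> = card \<tau> + 1" "finite \<sigma>"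
  using assms edges finite_vertices by (auto simp: cell_edges_def intro: finite_subset)

lemma same_edge:
  assumes "e \<in> A" "e' \<in> A" "fst e = \<sigma> \<or> snd e = \<sigma>" "fst e' = \<sigma> \<or> snd e' = \<sigma>"
  shows "e = e'"
  using matched_once[of \<sigma>] assms unfolding Uniq_def by blast

lemma target_unique: "(\<sigma>, \<tau>) \<in> A \<Longrightarrow> (\<sigma>, \<tau>') \<in> A \<Longrightarrow> \<tau> = \<tau>'"
  using same_edge[of "(\<sigma>, \<tau>)" "(\<sigma>, \<tau>')" \<sigma>] by simp

lemma source_unique: "(\<sigma>, \<tau>) \<in> A \<Longrightarrow> (\<sigma>', \<tau>) \<in> A \<Longrightarrow> \<sigma> = \<sigma>'"
  using same_edge[of "(\<sigma>, \<tau>)" "(\<sigma>', \<tau>)" \<tau>] by simp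

lemma source_not_target: "\<sigma> \<in> Domain A \<Longrightarrow> \<sigma> \<notin> Range A"
proof
  assume "\<sigma> \<in> Domain A" "\<sigma> \<in> Range A"
  then obtain \<tau> \<rho> where *: "(\<sigma>, \<tau>) \<in> A" "(\<rho>, \<sigma>) \<in> A" by blast
  hence "(\<sigma>, \<tau>) = (\<rho>, \<sigma>)" using same_edge[of "(\<sigma>, \<tau>)" "(\<rho>, \<sigma>)" \<sigma>] by simp
  thus False using edgeD(3)[OF *(1)] by simp
qed

lemma edge_source_minus_vertex:
  assumes "(\<sigma>, \<tau>) \<in> A"
  obtains x where "x \<in> \<sigma>" "\<tau> = \<sigma> - {x}" "\<sigma> = insert x \<tau>" "x \<notin> \<tau>"
proof -
  note * = edgeD[OF assms]
  have "card (\<sigma> - \<tau>) = 1"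
    using * by (simp add: card_Diff_subset finite_subset)
  then obtain x where "\<sigma> - \<tau> = {x}" by (auto simp: card_1_singleton_iff)
  thus thesis using *(2) by (intro that[of x]) auto
qed

lemma finite_R: "finite R"
proof (rule finite_subset)
  show "R \<subseteq> Pow S \<times> Pow S"
    using edges by (auto simp: reverse_edges_def cell_edges_def)
qed (simp add: finite_vertices)

lemma R_cases [consumes 1, case_names down up]:
  assumes "(\<sigma>, \<tau>) \<in> R"
  obtains (down) "\<sigma> \<subseteq> S" "\<tau> \<subseteq> \<sigma>" "card \<sigma> = card \<tau> + 1" "(\<sigma>, \<tau>) \<notin> A" "(\<tau>, \<sigma>) \<notin> A"
    | (up) "(\<tau>, \<sigma>) \<in> A"
proof (cases "(\<tau>, \<sigma>) \<in> A")
  case False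
  thus thesis using assms down by (auto simp: reverse_edges_def cell_edges_def)
qed (rule up)

text \<open>The cardinality, with targets raised to the level of their sources. Both directions of a matched pair
  are then level steps, and a directed path in \<open>R\<close> never gains height.\<close>

definition height :: "'a set \<Rightarrow> nat" where
  "height \<sigma> = card \<sigma> + (if \<sigma> \<in> Range A then 1 else 0)"

lemma height_step:
  assumes "(\<sigma>, \<tau>) \<in> R" shows "height \<tau> \<le> height \<sigma>"
  using assms
proof (cases rule: R_cases)
  case up
  moreover have "\<tau> \<notin> Range A" "\<sigma> \<in> Range A" using up source_not_target by auto
  ultimately show ?thesis using edgeD(3) by (simp add: height_def)
qed (auto simp: height_def)

lemma height_reachable: "(\<sigma>, \<tau>) \<in> R\<^sup>* \<Longrightarrow> height \<tau> \<le> height \<sigma>"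
  by (induction rule: rtrancl_induct) (auto dest: height_step)

end

locale acyclic_matching = matching +
  assumes acyclic: "acyclic (reverse_edges S A)"
begin

lemma wf_R: "wf (R\<inverse>)"
  by (rule finite_acyclic_wf_converse[OF finite_R acyclic])

text \<open>A critical cell can only be entered from above, since it has no matched edge. Hence a nontrivial
  path to it starts at greater height, which is what forces a nontrivial gradient path to a critical
  cell of the same cardinality to alternate between up and down steps, starting with an up step.\<close>

lemma reach_critical:
  assumes "(\<rho>, \<tau>) \<in> R\<^sup>*" "\<tau> \<in> critical S A" "\<rho> \<noteq> \<tau>"
  shows "card \<tau> + 1 \<le> height \<rho>"
proof -
  obtain \<sigma> where \<sigma>: "(\<rho>, \<sigma>) \<in> R\<^sup>*" "(\<sigma>, \<tau>) \<in> R"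
    using assms by (meson rtranclE)
  have "card \<sigma> = card \<tau> + 1"
    using \<sigma>(2) assms(2) by (cases rule: R_cases) (auto simp: critical_def Field_def)
  moreover have "card \<sigma> \<le> height \<sigma>" by (simp add: height_def)
  ultimately show ?thesis using height_reachable[OF \<sigma>(1)] by simp
qed

lemma gradient_paths_reach:
  assumes "P \<in> gradient_paths S A \<rho> \<tau>" shows "(\<rho>, \<tau>) \<in> R\<^sup>*"
proof -
  have "P \<noteq> [] \<Longrightarrow> successively (\<lambda>x y. (x, y) \<in> R) P \<Longrightarrow> (hd P, last P) \<in> R\<^sup>*" for P
  proof (induction P)
    case (Cons x P)
    show ?case
    proof (cases P)
      case (Cons y Q)
      thus ?thesis using Cons.IH Cons.prems
        by (auto simp: successively_Cons intro: converse_rtrancl_into_rtrancl)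
    qed simp
  qed simp
  thus ?thesis using assms by (auto simp: gradient_paths_def)
qed

text \<open>Splitting off the first edge. This recursion terminates because \<open>R\<close> is acyclic, and it yields both the
  finiteness of the set of gradient paths and a recursion for their weighted count.\<close>

lemma gradient_paths_unfold:
  "gradient_paths S A \<rho> \<tau> =
    (if \<rho> = \<tau> then {[\<rho>]} else {}) \<union> (\<Union>\<sigma>\<in>R `` {\<rho>}. (#) \<rho> ` gradient_paths S A \<sigma> \<tau>)"
    (is "?L = ?M")
proof (intro set_eqI iffI)
  fix P assume P: "P \<in> ?L"
  then obtain Q where Q: "P = \<rho> # Q"
    by (cases P) (auto simp: gradient_paths_def)
  show "P \<in> ?M"
  proof (cases Q)
    case Nil thus ?thesis using P Q by (auto simp: gradient_paths_def)
  next
    case (Cons \<sigma> Q')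
    thus ?thesis using P Q
      by (auto simp: gradient_paths_def successively_Cons intro!: bexI[of _ \<sigma>])
  qed
next
  fix P assume "P \<in> ?M"
  thus "P \<in> ?L"
    by (auto simp: gradient_paths_def successively_Cons split: if_splits)
qed

lemma finite_gradient_paths: "finite (gradient_paths S A \<rho> \<tau>)"
  using wf_R
proof (induction \<rho> rule: wf_induct_rule)
  case (less \<rho>)
  have "finite (R `` {\<rho>})" using finite_R by (simp add: finite_Image)
  thus ?case unfolding gradient_paths_unfold[of \<rho>] using less by auto
qed

definition path_sum :: "'a rel \<Rightarrow> 'a set \<Rightarrow> 'a set \<Rightarrow> int" where
  "path_sum v \<rho> \<tau> = (\<Sum>P\<in>gradient_paths S A \<rho> \<tau>. path_weight v A P)"

lemma path_sum_reach: "path_sum v \<rho> \<tau> \<noteq> 0 \<Longrightarrow> (\<rho>, \<tau>) \<in> R\<^sup>*"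
  unfolding path_sum_def by (metis gradient_paths_reach sum.neutral)

lemma path_sum_unfold:
  "path_sum v \<rho> \<tau> = (if \<rho> = \<tau> then 1 else 0) +
    (\<Sum>\<sigma>\<in>R `` {\<rho>}. edge_weight v A \<rho> \<sigma> * path_sum v \<sigma> \<tau>)"
proof -
  let ?G = "gradient_paths S A"
  let ?U = "\<Union>\<sigma>\<in>R `` {\<rho>}. (#) \<rho> ` ?G \<sigma> \<tau>"
  have fin: "finite (R `` {\<rho>})" using finite_R by (simp add: finite_Image)
  have notin: "[\<rho>] \<notin> ?U" by (auto simp: gradient_paths_def)
  have "path_sum v \<rho> \<tau> = (\<Sum>P\<in>(if \<rho> = \<tau> then {[\<rho>]} else {}). path_weight v A P) +
      (\<Sum>P\<in>?U. path_weight v A P)"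
    unfolding path_sum_def gradient_paths_unfold[of \<rho>]
    by (rule sum.union_disjoint) (use fin finite_gradient_paths notin in auto)
  also have "(\<Sum>P\<in>(if \<rho> = \<tau> then {[\<rho>]} else {}). path_weight v A P) = (if \<rho> = \<tau> then 1 else 0)"
    by (simp add: path_weight_def)
  also have "(\<Sum>P\<in>?U. path_weight v A P) =
      (\<Sum>\<sigma>\<in>R `` {\<rho>}. \<Sum>P\<in>(#) \<rho> ` ?G \<sigma> \<tau>. path_weight v A P)"
    by (rule sum.UNION_disjoint) (use fin finite_gradient_paths in \<open>auto simp: gradient_paths_def\<close>)
  also have "\<dots> = (\<Sum>\<sigma>\<in>R `` {\<rho>}. edge_weight v A \<rho> \<sigma> * path_sum v \<sigma> \<tau>)"
  proof (rule sum.cong[OF refl])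
    fix \<sigma>
    have "(\<Sum>P\<in>(#) \<rho> ` ?G \<sigma> \<tau>. path_weight v A P) = (\<Sum>P\<in>?G \<sigma> \<tau>. path_weight v A (\<rho> # P))"
      by (subst sum.reindex) (auto simp: inj_on_def)
    also have "\<dots> = (\<Sum>P\<in>?G \<sigma> \<tau>. edge_weight v A \<rho> \<sigma> * path_weight v A P)"
    proof (rule sum.cong[OF refl])
      fix P assume "P \<in> ?G \<sigma> \<tau>"
      hence "P \<noteq> []" "hd P = \<sigma>" by (auto simp: gradient_paths_def)
      thus "path_weight v A (\<rho> # P) = edge_weight v A \<rho> \<sigma> * path_weight v A P"
        by (cases P) (auto simp: path_weight_def)
    qed
    finally show "(\<Sum>P\<in>(#) \<rho> ` ?G \<sigma> \<tau>. path_weight v A P) = edge_weight v A \<rho> \<sigma> * path_sum v \<sigma> \<tau>"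
      by (simp add: path_sum_def sum_distrib_left)
  qed
  finally show ?thesis .
qed

text \<open>The signed number of gradient paths between cells of equal cardinality. As a function of its first
  argument it is the linear functional that sends a chain to the coefficient at \<open>\<tau>\<close> of its image in the
  critical chains. Three properties characterise it, and the Morse complex depends on it only through
  these: it vanishes on sources, it is a coordinate function on critical cells, and it vanishes on
  boundaries of sources. Other cardinalities are excluded because paths may also descend to lower
  critical cells.\<close>

definition flow :: "'a rel \<Rightarrow> 'a set \<Rightarrow> 'a set \<Rightarrow> int" where
  "flow v \<rho> \<tau> = (if card \<rho> = card \<tau> then path_sum v \<rho> \<tau> else 0)"

lemma flow_source:
  assumes "\<rho> \<in> Domain A" "\<tau> \<in> critical S A" shows "flow v \<rho> \<tau> = 0"
proof (rule ccontr)
  assume "flow v \<rho> \<tau> \<noteq> 0"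
  hence "card \<rho> = card \<tau>" "(\<rho>, \<tau>) \<in> R\<^sup>*"
    using path_sum_reach by (auto simp: flow_def split: if_splits)
  moreover have "\<rho> \<noteq> \<tau>" using assms by (auto simp: critical_def Field_def)
  moreover have "height \<rho> = card \<rho>" using source_not_target[OF assms(1)] by (simp add: height_def)
  ultimately show False using reach_critical[of \<rho> \<tau>] assms(2) by simp
qed

lemma flow_critical:
  assumes "\<rho> \<in> critical S A" "\<tau> \<in> critical S A"
  shows "flow v \<rho> \<tau> = (if \<rho> = \<tau> then 1 else 0)"
proof (cases "\<rho> = \<tau>")
  case True
  have "path_sum v \<sigma> \<rho> = 0" if "\<sigma> \<in> R `` {\<rho>}" for \<sigma>
  proof (rule ccontr)
    assume "path_sum v \<sigma> \<rho> \<noteq> 0"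
    hence "(\<rho>, \<rho>) \<in> R\<^sup>+" using that path_sum_reach by (metis Image_singleton_iff rtrancl_into_trancl2)
    thus False using acyclic by (simp add: acyclic_def)
  qed
  hence "(\<Sum>\<sigma>\<in>R `` {\<rho>}. edge_weight v A \<rho> \<sigma> * path_sum v \<sigma> \<rho>) = 0"
    by (intro sum.neutral) simp
  thus ?thesis using True path_sum_unfold[of v \<rho> \<rho>] by (simp add: flow_def)
next
  case False
  have "height \<rho> = card \<rho>" using assms(1) by (auto simp: critical_def Field_def height_def)
  hence "path_sum v \<rho> \<tau> = 0" if "card \<rho> = card \<tau>"
    using reach_critical[OF path_sum_reach assms(2) False] that by fastforce
  thus ?thesis using False by (simp add: flow_def)
qed

lemma facet_in_cell_edges:
  assumes "\<sigma> \<subseteq> S" "x \<in> \<sigma>" shows "(\<sigma>, \<sigma> - {x}) \<in> cell_edges S"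
proof -
  have "finite \<sigma>" using assms finite_vertices finite_subset by auto
  hence "card \<sigma> = card (\<sigma> - {x}) + 1"
    using assms(2) by (metis card_Suc_Diff1 Suc_eq_plus1)
  thus ?thesis using assms by (auto simp: cell_edges_def)
qed

text \<open>Let \<open>\<rho>\<close> be the target matched with \<open>\<sigma>\<close>. Gradient paths from \<open>\<sigma>\<close> to \<open>\<tau>\<close> start with a facet other
  than \<open>\<rho>\<close>, and gradient paths from \<open>\<rho>\<close> to \<open>\<tau>\<close> start with the step up to \<open>\<sigma>\<close>, whose weight is minus the
  incidence of \<open>\<rho>\<close>. So the term of \<open>\<rho>\<close> cancels those of the other facets.\<close>

lemma flow_boundary_source:
  assumes "\<sigma> \<in> Domain A" "\<tau> \<in> critical S A"
  shows "(\<Sum>x\<in>\<sigma>. vsign v x (\<sigma> - {x}) * flow v (\<sigma> - {x}) \<tau>) = 0"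
proof (cases "card \<sigma> = card \<tau> + 1")
  case False
  have "flow v (\<sigma> - {x}) \<tau> = 0" if x: "x \<in> \<sigma>" for x
  proof -
    have "finite \<sigma>" using assms(1) edgeD(4) by blast
    from card_Suc_Diff1[OF this x] False show ?thesis by (auto simp: flow_def)
  qed
  thus ?thesis by simp
next
  case card: True
  obtain \<rho> where A: "(\<sigma>, \<rho>) \<in> A" using assms(1) by auto
  obtain a where a: "a \<in> \<sigma>" "\<rho> = \<sigma> - {a}" using edge_source_minus_vertex[OF A] by metis
  note \<sigma> = edgeD[OF A]
  have flow: "flow v (\<sigma> - {x}) \<tau> = path_sum v (\<sigma> - {x}) \<tau>" if "x \<in> \<sigma>" for x
    using that card \<sigma>(4) by (simp add: flow_def card_Diff_singleton)
  have out\<sigma>: "R `` {\<sigma>} = (\<lambda>x. \<sigma> - {x}) ` (\<sigma> - {a})"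
  proof (intro set_eqI iffI)
    fix \<tau>' assume "\<tau>' \<in> R `` {\<sigma>}"
    hence "(\<sigma>, \<tau>') \<in> R" by simp
    thus "\<tau>' \<in> (\<lambda>x. \<sigma> - {x}) ` (\<sigma> - {a})"
    proof (cases rule: R_cases)
      case down
      have "card (\<sigma> - \<tau>') = 1"
        using down \<sigma>(4) by (simp add: card_Diff_subset finite_subset)
      then obtain x where "\<sigma> - \<tau>' = {x}" by (auto simp: card_1_singleton_iff)
      hence "\<tau>' = \<sigma> - {x}" "x \<in> \<sigma>" using down(2) by auto
      thus ?thesis using down(4) A a by auto
    next
      case up
      thus ?thesis using A source_not_target by blast
    qed
  next
    fix \<tau>' assume "\<tau>' \<in> (\<lambda>x. \<sigma> - {x}) ` (\<sigma> - {a})"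
    then obtain x where x: "\<tau>' = \<sigma> - {x}" "x \<in> \<sigma>" "x \<noteq> a" by auto
    have "(\<sigma>, \<tau>') \<notin> A" using target_unique[OF A] x a by auto
    thus "\<tau>' \<in> R `` {\<sigma>}" using facet_in_cell_edges[OF \<sigma>(1) x(2)] x(1) by (simp add: reverse_edges_def)
  qed
  have "\<sigma> \<noteq> \<tau>" using assms by (auto simp: critical_def Field_def)
  hence "path_sum v \<sigma> \<tau> = (\<Sum>x\<in>\<sigma> - {a}. edge_weight v A \<sigma> (\<sigma> - {x}) * path_sum v (\<sigma> - {x}) \<tau>)"
    unfolding path_sum_unfold[of v \<sigma>] out\<sigma>
    by (subst sum.reindex) (auto simp: inj_on_def)
  also have "\<dots> = (\<Sum>x\<in>\<sigma> - {a}. vsign v x (\<sigma> - {x}) * path_sum v (\<sigma> - {x}) \<tau>)"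
  proof (rule sum.cong[OF refl])
    fix x assume x: "x \<in> \<sigma> - {a}"
    have "(\<sigma> - {x}, \<sigma>) \<notin> A" using A source_not_target by blast
    thus "edge_weight v A \<sigma> (\<sigma> - {x}) * path_sum v (\<sigma> - {x}) \<tau> =
        vsign v x (\<sigma> - {x}) * path_sum v (\<sigma> - {x}) \<tau>"
      using x by (simp add: edge_weight_def incidence_remove)
  qed
  finally have up: "path_sum v \<sigma> \<tau> = \<dots>" .
  have "\<rho> \<noteq> \<tau>" using A assms(2) by (auto simp: critical_def Field_def)
  hence "path_sum v \<rho> \<tau> = (\<Sum>\<xi>\<in>R `` {\<rho>}. edge_weight v A \<rho> \<xi> * path_sum v \<xi> \<tau>)"
    unfolding path_sum_unfold[of v \<rho>] by simp
  also have "\<dots> = (\<Sum>\<xi>\<in>{\<sigma>}. edge_weight v A \<rho> \<xi> * path_sum v \<xi> \<tau>)"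
  proof (rule sum.mono_neutral_right)
    show "finite (R `` {\<rho>})" using finite_R by (simp add: finite_Image)
    show "{\<sigma>} \<subseteq> R `` {\<rho>}" using A by (simp add: reverse_edges_def)
    show "\<forall>\<xi>\<in>R `` {\<rho>} - {\<sigma>}. edge_weight v A \<rho> \<xi> * path_sum v \<xi> \<tau> = 0"
    proof
      fix \<xi> assume \<xi>: "\<xi> \<in> R `` {\<rho>} - {\<sigma>}"
      hence "(\<rho>, \<xi>) \<in> R" by simp
      \<comment> \<open>The step up from \<open>\<rho>\<close> is unique, so any other step goes down, to a level from which \<open>\<tau>\<close> is out of reach.\<close>
      hence "card \<rho> = card \<xi> + 1"
        using \<xi> A source_unique by (cases rule: R_cases) auto
      hence "height \<xi> \<le> card \<rho>" "\<xi> \<noteq> \<tau>" using card \<sigma>(3) by (auto simp: height_def)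
      hence "path_sum v \<xi> \<tau> = 0"
        using reach_critical[OF path_sum_reach assms(2)] card \<sigma>(3) by fastforce
      thus "edge_weight v A \<rho> \<xi> * path_sum v \<xi> \<tau> = 0" by simp
    qed
  qed
  also have "\<dots> = - vsign v a (\<sigma> - {a}) * path_sum v \<sigma> \<tau>"
    using A a by (simp add: edge_weight_def incidence_remove)
  finally have "vsign v a (\<sigma> - {a}) * path_sum v (\<sigma> - {a}) \<tau> =
      - (vsign v a (\<sigma> - {a}) * vsign v a (\<sigma> - {a})) * path_sum v \<sigma> \<tau>"
    unfolding a(2) by (simp del: vsign_square)
  hence "vsign v a (\<sigma> - {a}) * path_sum v (\<sigma> - {a}) \<tau> + path_sum v \<sigma> \<tau> = 0" by simp
  hence "(\<Sum>x\<in>\<sigma>. vsign v x (\<sigma> - {x}) * path_sum v (\<sigma> - {x}) \<tau>) = 0"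
    unfolding up using sum.remove[OF \<sigma>(4) a(1), of "\<lambda>x. vsign v x (\<sigma> - {x}) * path_sum v (\<sigma> - {x}) \<tau>"]
    by simp
  thus ?thesis using flow by simp
qed

end

section \<open>The Morse complex of an acyclic matching\<close>

definition morse_coeff :: "'a rel \<Rightarrow> ('a set \<Rightarrow> 'a set \<Rightarrow> int) \<Rightarrow> 'a set \<Rightarrow> 'a set \<Rightarrow> int" where
  "morse_coeff v \<Gamma> \<sigma> \<tau> = (\<Sum>x\<in>\<sigma>. vsign v x (\<sigma> - {x}) * \<Gamma> (\<sigma> - {x}) \<tau>)"

text \<open>The path count enters only through the three properties that characterise it. The vertex set \<open>V\<close>
  may therefore vary while \<open>\<Gamma>\<close> stays fixed, and paths need not be compared between different simplices.\<close>

locale morse_complex = acyclic_matching V A for V :: "'a set" and A +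
  fixes v :: "'a rel" and \<Gamma> :: "'a set \<Rightarrow> 'a set \<Rightarrow> int"
  assumes oriented: "oriented V v"
    and \<Gamma>_source: "\<rho> \<in> Domain A \<Longrightarrow> \<tau> \<in> critical V A \<Longrightarrow> \<Gamma> \<rho> \<tau> = 0"
    and \<Gamma>_critical: "\<rho> \<in> critical V A \<Longrightarrow> \<tau> \<in> critical V A \<Longrightarrow> \<Gamma> \<rho> \<tau> = (if \<rho> = \<tau> then 1 else 0)"
    and \<Gamma>_boundary_source: "\<sigma> \<in> Domain A \<Longrightarrow> \<tau> \<in> critical V A \<Longrightarrow> morse_coeff v \<Gamma> \<sigma> \<tau> = 0"
begin

abbreviation Crit where "Crit \<equiv> critical V A"

definition morse_bd :: "('a set \<Rightarrow> 'k::comm_ring_1) \<Rightarrow> 'a set \<Rightarrow> 'k" where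
  "morse_bd c \<tau> = (\<Sum>\<sigma>\<in>Crit. of_int (morse_coeff v \<Gamma> \<sigma> \<tau>) * c \<sigma>)"

lemma cell_cases:
  assumes "\<sigma> \<subseteq> V"
  obtains "\<sigma> \<in> Crit" | "\<sigma> \<in> Domain A" | "\<sigma> \<in> Range A"
  using assms by (auto simp: critical_def Field_def)

lemma source_cell: "\<sigma> \<in> Domain A \<Longrightarrow> \<sigma> \<subseteq> V"
  using edgeD(1) by blast

lemma target_cell: "\<sigma> \<in> Range A \<Longrightarrow> \<sigma> \<subseteq> V"
  using edgeD(1,2) by blast

lemma critD: "\<sigma> \<in> Crit \<Longrightarrow> \<sigma> \<subseteq> V \<and> \<sigma> \<notin> Domain A \<and> \<sigma> \<notin> Range A"
  by (auto simp: critical_def Field_def)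

text \<open>This is why the source-to-target block of the boundary is triangular: the other sources with the
  facet \<open>\<tau>\<close> all reach \<open>\<sigma>\<close> in \<open>R\<close>, by stepping down to \<open>\<tau>\<close> and up to \<open>\<sigma>\<close>.\<close>

lemma competing_source_reachable:
  assumes "(\<sigma>, \<tau>) \<in> A" "x \<in> V - \<tau>" "insert x \<tau> \<noteq> \<sigma>"
  shows "(insert x \<tau>, \<sigma>) \<in> R\<^sup>+"
proof -
  note e = edgeD[OF assms(1)]
  have fin: "finite \<tau>" using e finite_subset by blast
  have "(insert x \<tau>, \<tau>) \<in> cell_edges V"
    using assms(2) e fin by (auto simp: cell_edges_def)
  moreover have "(insert x \<tau>, \<tau>) \<notin> A" using source_unique assms by blast
  ultimately have "(insert x \<tau>, \<tau>) \<in> R" by (simp add: reverse_edges_def)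
  moreover have "(\<tau>, \<sigma>) \<in> R" using assms(1) by (simp add: reverse_edges_def)
  ultimately show ?thesis by (meson trancl.simps)
qed

lemma bd_at_target:
  fixes s :: "'a set \<Rightarrow> 'k::comm_ring_1"
  assumes "(\<sigma>, \<tau>) \<in> A" "a \<in> V - \<tau>" "\<sigma> = insert a \<tau>"
  shows "bd V v s \<tau> = of_int (vsign v a \<tau>) * s \<sigma> +
    (\<Sum>x\<in>V - \<tau> - {a}. of_int (vsign v x \<tau>) * s (insert x \<tau>))"
  unfolding bd_def
  by (subst sum.remove[of _ a]) (use assms finite_vertices in auto)

text \<open>Injectivity of the source-to-target block, by induction along \<open>R\<close>: the equation at the target of
  \<open>\<sigma>\<close> involves, apart from \<open>s \<sigma>\<close>, only sources that reach \<open>\<sigma>\<close>.\<close>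

lemma source_chain_determined:
  fixes s :: "'a set \<Rightarrow> 'k::comm_ring_1"
  assumes s: "chain_on (Domain A) s" and zero: "\<And>\<tau>. \<tau> \<in> Range A \<Longrightarrow> bd V v s \<tau> = 0"
  shows "s \<sigma> = 0"
proof -
  have "wf (R\<^sup>+)" using finite_acyclic_wf[OF finite_R acyclic] by (rule wf_trancl)
  thus ?thesis
  proof (induction \<sigma> rule: wf_induct_rule)
    case (less \<sigma>)
    show ?case
    proof (cases "\<sigma> \<in> Domain A")
      case True
      then obtain \<tau> where A: "(\<sigma>, \<tau>) \<in> A" by auto
      obtain a where a: "a \<in> \<sigma>" "\<sigma> = insert a \<tau>" "a \<notin> \<tau>"
        using edge_source_minus_vertex[OF A] by metis
      have aV: "a \<in> V - \<tau>" using a edgeD(1)[OF A] by auto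
      have "s (insert x \<tau>) = 0" if "x \<in> V - \<tau> - {a}" for x
        using less competing_source_reachable[OF A, of x] that a by (metis DiffE insert_iff)
      hence "of_int (vsign v a \<tau>) * s \<sigma> = 0"
        using bd_at_target[OF A aV a(2), of s] zero[of \<tau>] A by auto
      hence "of_int (vsign v a \<tau> * vsign v a \<tau>) * s \<sigma> = 0"
        by (simp add: mult.assoc del: vsign_square)
      thus ?thesis by simp
    qed (rule chain_onD[OF s])
  qed
qed

text \<open>Surjectivity of the source-to-target block: the triangular system is solved by recursion along \<open>R\<close>.
  Its diagonal entries are signs, so this works over every commutative ring.\<close>

lemma source_chain_exists:
  fixes t :: "'a set \<Rightarrow> 'k::comm_ring_1"
  obtains s where "chain_on (Domain A) s" "\<And>\<tau>. \<tau> \<in> Range A \<Longrightarrow> bd V v s \<tau> = t \<tau>"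
proof -
  define rest :: "('a set \<Rightarrow> 'k) \<Rightarrow> 'a set \<Rightarrow> 'a set \<Rightarrow> 'k" where
    "rest s \<sigma> \<tau> = (\<Sum>x | x \<in> V - \<tau> \<and> insert x \<tau> \<noteq> \<sigma>. of_int (vsign v x \<tau>) * s (insert x \<tau>))" for s \<sigma> \<tau>
  define P where "P s \<sigma> r \<longleftrightarrow> (\<sigma> \<notin> Domain A \<longrightarrow> r = 0) \<and>
    (\<forall>\<tau> a. (\<sigma>, \<tau>) \<in> A \<and> \<sigma> - \<tau> = {a} \<longrightarrow> r = of_int (vsign v a \<tau>) * (t \<tau> - rest s \<sigma> \<tau>))" for s \<sigma> r
  have "\<exists>s. \<forall>\<sigma>. P s \<sigma> (s \<sigma>)"
  proof (rule dependent_wf_choice)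
    show "wf (R\<^sup>+)" using finite_acyclic_wf[OF finite_R acyclic] by (rule wf_trancl)
    show "P s \<sigma> r = P s' \<sigma> r" if eq: "\<And>\<xi>. (\<xi>, \<sigma>) \<in> R\<^sup>+ \<Longrightarrow> s \<xi> = s' \<xi>" for s s' \<sigma> r
    proof -
      have "rest s \<sigma> \<tau> = rest s' \<sigma> \<tau>" if A: "(\<sigma>, \<tau>) \<in> A" for \<tau>
        unfolding rest_def by (rule sum.cong) (use eq competing_source_reachable[OF A] in auto)
      thus ?thesis unfolding P_def by metis
    qed
    show "\<exists>r. P s \<sigma> r" for \<sigma> s
    proof (cases "\<exists>\<tau> a. (\<sigma>, \<tau>) \<in> A \<and> \<sigma> - \<tau> = {a}")
      case True
      then obtain \<tau> a where *: "(\<sigma>, \<tau>) \<in> A" "\<sigma> - \<tau> = {a}" by auto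
      have "P s \<sigma> (of_int (vsign v a \<tau>) * (t \<tau> - rest s \<sigma> \<tau>))"
        unfolding P_def using * target_unique by (metis DomainI singleton_inject)
      thus ?thesis ..
    next
      case False thus ?thesis unfolding P_def by blast
    qed
  qed
  then obtain s where s: "\<And>\<sigma>. P s \<sigma> (s \<sigma>)" by blast
  show thesis
  proof (rule that[of s])
    show "chain_on (Domain A) s" using s by (auto simp: chain_on_def P_def)
    fix \<tau> assume "\<tau> \<in> Range A"
    then obtain \<sigma> where A: "(\<sigma>, \<tau>) \<in> A" by auto
    obtain a where a: "a \<in> \<sigma>" "\<sigma> = insert a \<tau>" "a \<notin> \<tau>"
      using edge_source_minus_vertex[OF A] by metis
    have aV: "a \<in> V - \<tau>" using a edgeD(1)[OF A] by auto
    have "\<sigma> - \<tau> = {a}" using a by auto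
    hence sa: "s \<sigma> = of_int (vsign v a \<tau>) * (t \<tau> - rest s \<sigma> \<tau>)"
      using s[of \<sigma>] A unfolding P_def by blast
    have "{x. x \<in> V - \<tau> \<and> insert x \<tau> \<noteq> \<sigma>} = V - \<tau> - {a}" using a by auto
    hence "bd V v s \<tau> = of_int (vsign v a \<tau> * vsign v a \<tau>) * (t \<tau> - rest s \<sigma> \<tau>) + rest s \<sigma> \<tau>"
      unfolding bd_at_target[OF A aV a(2)] sa by (simp add: rest_def mult.assoc del: vsign_square)
    thus "bd V v s \<tau> = t \<tau>" by simp
  qed
qed

text \<open>Both sides evaluate the functional \<open>\<Gamma>\<close> on the boundary of \<open>u\<close>; on the right the sum is arranged by the cells
  of \<open>u\<close>.\<close>

lemma sum_bd_\<Gamma>: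
  fixes u :: "'a set \<Rightarrow> 'k::comm_ring_1"
  shows "(\<Sum>\<rho>\<in>Pow V. bd V v u \<rho> * of_int (\<Gamma> \<rho> \<tau>)) =
    (\<Sum>\<sigma>\<in>Pow V. of_int (morse_coeff v \<Gamma> \<sigma> \<tau>) * u \<sigma>)"
proof -
  have fin: "finite (Pow V)" "\<And>\<sigma>. \<sigma> \<subseteq> V \<Longrightarrow> finite \<sigma>" "\<And>\<sigma>. finite (V - \<sigma>)"
    using finite_vertices finite_subset by auto
  let ?g = "\<lambda>\<rho> x. of_int (vsign v x \<rho>) * u (insert x \<rho>) * of_int (\<Gamma> \<rho> \<tau>)"
  have "(\<Sum>\<rho>\<in>Pow V. bd V v u \<rho> * of_int (\<Gamma> \<rho> \<tau>)) =
      (\<Sum>(\<rho>, x)\<in>(SIGMA \<rho>:Pow V. V - \<rho>). ?g \<rho> x)"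
    unfolding bd_def sum_distrib_right by (rule sum.Sigma) (use fin in auto)
  also have "\<dots> = (\<Sum>(\<sigma>, x)\<in>(SIGMA \<sigma>:Pow V. \<sigma>). ?g (\<sigma> - {x}) x)"
    by (rule sum.reindex_bij_witness[of _ "\<lambda>(\<sigma>, x). (\<sigma> - {x}, x)" "\<lambda>(\<rho>, x). (insert x \<rho>, x)"]) auto
  also have "\<dots> = (\<Sum>\<sigma>\<in>Pow V. \<Sum>x\<in>\<sigma>. ?g (\<sigma> - {x}) x)"
    by (rule sum.Sigma[symmetric]) (use fin in auto)
  also have "\<dots> = (\<Sum>\<sigma>\<in>Pow V. of_int (morse_coeff v \<Gamma> \<sigma> \<tau>) * u \<sigma>)"
    unfolding morse_coeff_def of_int_sum sum_distrib_right
    by (intro sum.cong refl) (auto simp: insert_absorb)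
  finally show ?thesis .
qed

text \<open>On chains such that neither they nor their boundary have a target component, the simplicial boundary
  and the Morse differential agree at critical cells: in the identity above only \<open>\<tau>\<close> contributes
  on the left and only critical cells contribute on the right.\<close>

lemma bd_critical:
  fixes u :: "'a set \<Rightarrow> 'k::comm_ring_1"
  assumes u: "\<And>\<sigma>. \<sigma> \<in> Range A \<Longrightarrow> u \<sigma> = 0" "\<And>\<sigma>. \<sigma> \<in> Range A \<Longrightarrow> bd V v u \<sigma> = 0"
    and \<tau>: "\<tau> \<in> Crit"
  shows "bd V v u \<tau> = morse_bd u \<tau>"
proof -
  have fin: "finite (Pow V)" using finite_vertices by simp
  have "bd V v u \<rho> * of_int (\<Gamma> \<rho> \<tau>) = 0" if "\<rho> \<subseteq> V" "\<rho> \<noteq> \<tau>" for \<rho>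
    using that(1) by (cases rule: cell_cases) (use u \<tau> that \<Gamma>_critical \<Gamma>_source in auto)
  hence "(\<Sum>\<rho>\<in>Pow V. bd V v u \<rho> * of_int (\<Gamma> \<rho> \<tau>)) = (\<Sum>\<rho>\<in>{\<tau>}. bd V v u \<rho> * of_int (\<Gamma> \<rho> \<tau>))"
    by (intro sum.mono_neutral_right) (use fin critD[OF \<tau>] in auto)
  moreover have "(\<Sum>\<sigma>\<in>Pow V. of_int (morse_coeff v \<Gamma> \<sigma> \<tau>) * u \<sigma>) = morse_bd u \<tau>"
    unfolding morse_bd_def
  proof (rule sum.mono_neutral_right[OF fin])
    show "\<forall>\<sigma>\<in>Pow V - Crit. of_int (morse_coeff v \<Gamma> \<sigma> \<tau>) * u \<sigma> = 0"
      using u \<Gamma>_boundary_source \<tau> cell_cases by (metis DiffE PowD mult_zero_left mult_zero_right of_int_0)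
  qed (use critD in auto)
  ultimately show ?thesis using sum_bd_\<Gamma>[of u \<tau>] \<Gamma>_critical[OF \<tau> \<tau>] by simp
qed

lemma morse_bd_cong: "(\<And>\<sigma>. \<sigma> \<in> Crit \<Longrightarrow> b \<sigma> = c \<sigma>) \<Longrightarrow> morse_bd b \<tau> = morse_bd c \<tau>"
  by (simp add: morse_bd_def)

text \<open>Subtracting a source chain corrects the target component of the boundary and changes nothing on the
  critical cells.\<close>

lemma critical_chain_lift:
  fixes c :: "'a set \<Rightarrow> 'k::comm_ring_1"
  assumes c: "chain_on Crit c"
  obtains u where "chain_on (Pow V) u" "\<And>\<sigma>. \<sigma> \<in> Crit \<Longrightarrow> u \<sigma> = c \<sigma>"
    "\<And>\<sigma>. \<sigma> \<in> Range A \<Longrightarrow> u \<sigma> = 0" "\<And>\<sigma>. \<sigma> \<in> Range A \<Longrightarrow> bd V v u \<sigma> = 0"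
proof -
  obtain s where s: "chain_on (Domain A) s" "\<And>\<tau>. \<tau> \<in> Range A \<Longrightarrow> bd V v s \<tau> = bd V v c \<tau>"
    using source_chain_exists[of "bd V v c"] by blast
  show thesis
  proof (rule that[of "\<lambda>\<sigma>. c \<sigma> - s \<sigma>"])
    show "chain_on (Pow V) (\<lambda>\<sigma>. c \<sigma> - s \<sigma>)"
      unfolding chain_on_def
    proof (intro allI impI)
      fix \<sigma> assume "c \<sigma> - s \<sigma> \<noteq> 0"
      hence "c \<sigma> \<noteq> 0 \<or> s \<sigma> \<noteq> 0" by auto
      thus "\<sigma> \<in> Pow V" using c s(1) critD source_cell unfolding chain_on_def by blast
    qed
    show "c \<sigma> - s \<sigma> = c \<sigma>" if "\<sigma> \<in> Crit" for \<sigma>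
      using chain_onD[OF s(1)] critD[OF that] by simp
    show "c \<sigma> - s \<sigma> = 0" if "\<sigma> \<in> Range A" for \<sigma>
      using chain_onD[OF s(1)] chain_onD[OF c] critD source_not_target that by (metis diff_zero)
    show "bd V v (\<lambda>\<sigma>. c \<sigma> - s \<sigma>) \<sigma> = 0" if "\<sigma> \<in> Range A" for \<sigma>
      using s(2)[OF that] by (simp add: bd_diff)
  qed
qed

text \<open>If \<open>u\<close> lifts \<open>c\<close>, then its boundary is again a chain to which the comparison with the simplicial
  boundary applies, and it restricts to the Morse differential of \<open>c\<close>.\<close>

theorem morse_bd_morse_bd:
  fixes c :: "'a set \<Rightarrow> 'k::comm_ring_1"
  assumes c: "chain_on Crit c" and \<tau>: "\<tau> \<in> Crit"
  shows "morse_bd (morse_bd c) \<tau> = 0"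
proof -
  obtain u where u: "chain_on (Pow V) u" "\<And>\<sigma>. \<sigma> \<in> Crit \<Longrightarrow> u \<sigma> = c \<sigma>"
    "\<And>\<sigma>. \<sigma> \<in> Range A \<Longrightarrow> u \<sigma> = 0" "\<And>\<sigma>. \<sigma> \<in> Range A \<Longrightarrow> bd V v u \<sigma> = 0"
    using critical_chain_lift[OF c] by blast
  have bdu: "bd V v u \<sigma> = morse_bd c \<sigma>" if "\<sigma> \<in> Crit" for \<sigma>
    using bd_critical[OF u(3,4) that] morse_bd_cong[of u c] u(2) by simp
  have bdbd: "bd V v (bd V v u) \<sigma> = 0" if "\<sigma> \<subseteq> V" for \<sigma>
    using bd_bd[OF finite_vertices oriented that] .
  have "morse_bd (bd V v u) \<tau> = bd V v (bd V v u) \<tau>"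
    by (rule bd_critical[symmetric, OF u(4) bdbd[OF target_cell] \<tau>])
  also have "\<dots> = 0" using bdbd critD[OF \<tau>] by simp
  finally show ?thesis using morse_bd_cong[of "bd V v u" "morse_bd c"] bdu by simp
qed

text \<open>The lift \<open>u\<close> of a Morse cycle is a simplicial cycle, since its boundary is supported on sources
  and so must vanish. Write \<open>u\<close> as the boundary of \<open>z\<close> in the cone. Subtracting from \<open>z\<close> the boundary of a
  source chain removes the target component of \<open>z\<close>, and the critical part of the result has
  Morse differential \<open>c\<close>.\<close>

theorem morse_complex_exact:
  fixes c :: "'a set \<Rightarrow> 'k::comm_ring_1"
  assumes "V \<noteq> {}" and c: "chain_on Crit c" and cycle: "\<And>\<tau>. \<tau> \<in> Crit \<Longrightarrow> morse_bd c \<tau> = 0"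
  obtains e where "chain_on Crit e" "\<And>\<tau>. \<tau> \<in> Crit \<Longrightarrow> morse_bd e \<tau> = c \<tau>"
proof -
  obtain u where u: "chain_on (Pow V) u" "\<And>\<sigma>. \<sigma> \<in> Crit \<Longrightarrow> u \<sigma> = c \<sigma>"
    "\<And>\<sigma>. \<sigma> \<in> Range A \<Longrightarrow> u \<sigma> = 0" "\<And>\<sigma>. \<sigma> \<in> Range A \<Longrightarrow> bd V v u \<sigma> = 0"
    using critical_chain_lift[OF c] by blast
  have crit0: "bd V v u \<sigma> = 0" if "\<sigma> \<in> Crit" for \<sigma>
    using bd_critical[OF u(3,4) that] morse_bd_cong[of u c] u(2) cycle[OF that] by simp
  have "chain_on (Domain A) (bd V v u)"
    unfolding chain_on_def
  proof (intro allI impI)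
    fix \<sigma> assume nz: "bd V v u \<sigma> \<noteq> 0"
    hence "\<sigma> \<subseteq> V" using chain_onD[OF chain_on_bd[OF u(1)], of \<sigma> v] by blast
    thus "\<sigma> \<in> Domain A" by (cases rule: cell_cases) (use nz crit0 u(4) in auto)
  qed
  moreover have "bd V v (bd V v u) \<tau> = 0" if "\<tau> \<in> Range A" for \<tau>
    using bd_bd[OF finite_vertices oriented target_cell[OF that]] .
  ultimately have "bd V v u \<sigma> = 0" for \<sigma>
    by (rule source_chain_determined)
  then obtain z where z: "chain_on (Pow V) z" "\<And>\<tau>. \<tau> \<subseteq> V \<Longrightarrow> bd V v z \<tau> = u \<tau>"
    using cone_exact[OF finite_vertices oriented assms(1) u(1)] by metis
  obtain s where s: "chain_on (Domain A) s" "\<And>\<tau>. \<tau> \<in> Range A \<Longrightarrow> bd V v s \<tau> = z \<tau>"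
    using source_chain_exists[of z] by blast
  define w where "w \<sigma> = z \<sigma> - bd V v s \<sigma>" for \<sigma>
  have bdw: "bd V v w \<tau> = u \<tau>" if "\<tau> \<subseteq> V" for \<tau>
    unfolding w_def bd_diff using z(2)[OF that] bd_bd[OF finite_vertices oriented that, of s] by simp
  have bdc: "morse_bd w \<tau> = c \<tau>" if "\<tau> \<in> Crit" for \<tau>
  proof -
    have "morse_bd w \<tau> = bd V v w \<tau>"
    proof (rule bd_critical[symmetric, OF _ _ that])
      show "w \<sigma> = 0" if "\<sigma> \<in> Range A" for \<sigma> using s(2)[OF that] by (simp add: w_def)
      show "bd V v w \<sigma> = 0" if "\<sigma> \<in> Range A" for \<sigma>
        using bdw[OF target_cell[OF that]] u(3)[OF that] by simp
    qed
    thus ?thesis using bdw critD[OF that] u(2)[OF that] by simp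
  qed
  define e where "e \<sigma> = (if \<sigma> \<in> Crit then w \<sigma> else 0)" for \<sigma>
  show thesis
  proof (rule that[of e])
    show "chain_on Crit e" by (simp add: chain_on_def e_def)
    show "morse_bd e \<tau> = c \<tau>" if "\<tau> \<in> Crit" for \<tau>
      using morse_bd_cong[of e w] bdc[OF that] by (simp add: e_def)
  qed
qed

end

section \<open>The graded resolution induced by an acyclic matching\<close>

locale homogeneous_matching = acyclic_matching S A
  for S :: "'n::finite monomial set" and A +
  fixes v :: "'n monomial rel"
  assumes vertex_order: "linear_order_on S v"
    and lcm_preserved: "(\<sigma>, \<tau>) \<in> A \<Longrightarrow> lcm_mono \<sigma> = lcm_mono \<tau>"
begin

abbreviation B where "B \<equiv> critical_cells S A"

abbreviation coeff where "coeff \<equiv> morse_coeff v (flow v)"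

text \<open>The vertices of the simplex that carries the strand of degree \<open>a\<close>.\<close>

definition below :: "'n monomial \<Rightarrow> 'n monomial set" where
  "below a = {m \<in> S. mono_dvd m a}"

definition A_below :: "'n monomial \<Rightarrow> 'n monomial set rel" where
  "A_below a = A \<inter> Pow (below a) \<times> Pow (below a)"

lemma finite_cell: "\<sigma> \<subseteq> S \<Longrightarrow> finite \<sigma>"
  using finite_vertices finite_subset by blast

lemma subset_below_iff: "\<sigma> \<subseteq> S \<Longrightarrow> \<sigma> \<subseteq> below a \<longleftrightarrow> mono_dvd (lcm_mono \<sigma>) a"
  using lcm_mono_dvd_iff[OF finite_cell] by (auto simp: below_def)

lemma lcm_mono_mono:
  assumes "\<sigma> \<subseteq> S" "\<tau> \<subseteq> \<sigma>" shows "mono_dvd (lcm_mono \<tau>) (lcm_mono \<sigma>)"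
proof -
  have "finite \<tau>" "finite \<sigma>" using assms finite_cell by blast+
  thus ?thesis using assms lcm_mono_dvd_iff mono_dvd_refl by (metis subsetD)
qed

lemma below_subset: "below a \<subseteq> S"
  by (auto simp: below_def)

text \<open>A matched pair has a common lcm, so the matching restricts to each simplex \<open>below a\<close> without splitting
  any pair.\<close>

lemma A_below_iff: "(\<sigma>, \<tau>) \<in> A_below a \<longleftrightarrow> (\<sigma>, \<tau>) \<in> A \<and> (\<sigma> \<subseteq> below a \<or> \<tau> \<subseteq> below a)"
proof -
  have "\<sigma> \<subseteq> below a \<longleftrightarrow> \<tau> \<subseteq> below a" if "(\<sigma>, \<tau>) \<in> A"
    using edgeD(1,2)[OF that] lcm_preserved[OF that] subset_below_iff by (metis order_trans)
  thus ?thesis by (auto simp: A_below_def)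
qed

lemma critical_below: "critical (below a) (A_below a) = critical S A \<inter> Pow (below a)"
  unfolding critical_def Field_def using below_subset[of a] by (auto simp: A_below_iff)

lemma below_matching: "acyclic_matching (below a) (A_below a)"
proof
  show "finite (below a)" using finite_vertices below_subset finite_subset by blast
  show "A_below a \<subseteq> cell_edges (below a)"
    using edges by (auto simp: A_below_def cell_edges_def)
  show "\<exists>\<^sub>\<le>\<^sub>1 e. e \<in> A_below a \<and> (fst e = \<sigma> \<or> snd e = \<sigma>)" for \<sigma>
    using matched_once[of \<sigma>] unfolding Uniq_def A_below_def by blast
  have "reverse_edges (below a) (A_below a) \<subseteq> R"
  proof
    fix e assume "e \<in> reverse_edges (below a) (A_below a)"
    then obtain \<sigma> \<tau> where e: "e = (\<sigma>, \<tau>)" "(\<sigma>, \<tau>) \<in> reverse_edges (below a) (A_below a)"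
      by (cases e) auto
    thus "e \<in> R" using below_subset[of a]
      by (auto simp: reverse_edges_def cell_edges_def A_below_iff)
  qed
  thus "acyclic (reverse_edges (below a) (A_below a))"
    using acyclic acyclic_subset by blast
qed

lemma below_complex: "morse_complex (below a) (A_below a) v (flow v)"
proof -
  interpret b: acyclic_matching "below a" "A_below a" by (rule below_matching)
  have D: "Domain (A_below a) \<subseteq> Domain A" by (auto simp: A_below_def)
  have C: "critical (below a) (A_below a) \<subseteq> critical S A" by (simp add: critical_below)
  show ?thesis
  proof
    show "oriented (below a) v" by (rule linear_order_oriented[OF vertex_order below_subset])
  qed (use flow_source flow_critical flow_boundary_source D C in \<open>auto simp: morse_coeff_def subset_iff\<close>)
qed

abbreviation crit_below where "crit_below a \<equiv> critical (below a) (A_below a)"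

abbreviation bd_below :: "'n monomial \<Rightarrow> ('n monomial set \<Rightarrow> 'k::field) \<Rightarrow> 'n monomial set \<Rightarrow> 'k" where
  "bd_below a \<equiv> morse_complex.morse_bd (below a) (A_below a) v (flow v)"

lemma bd_below_eq: "bd_below a c \<tau> = (\<Sum>\<sigma>\<in>crit_below a. of_int (coeff \<sigma> \<tau>) * c \<sigma>)"
  by (rule morse_complex.morse_bd_def[OF below_complex])

lemma reach_lcm: "(\<rho>, \<tau>) \<in> R\<^sup>* \<Longrightarrow> mono_dvd (lcm_mono \<tau>) (lcm_mono \<rho>)"
proof (induction rule: rtrancl_induct)
  case (step \<sigma> \<tau>)
  have "mono_dvd (lcm_mono \<tau>) (lcm_mono \<sigma>)"
    using step(2) by (cases rule: R_cases) (auto simp: lcm_mono_mono lcm_preserved)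
  thus ?case using step mono_dvd_trans by blast
qed simp

text \<open>The differential lowers the cardinality by one, and the truncated difference of lcms in its
  coefficients is a true quotient whenever the integer coefficient is nonzero.\<close>

lemma coeff_nonzero:
  assumes "\<sigma> \<subseteq> S" "coeff \<sigma> \<tau> \<noteq> 0"
  shows "card \<sigma> = Suc (card \<tau>)" "mono_dvd (lcm_mono \<tau>) (lcm_mono \<sigma>)"
proof -
  obtain x where x: "x \<in> \<sigma>" "flow v (\<sigma> - {x}) \<tau> \<noteq> 0"
    using assms(2) unfolding morse_coeff_def by (metis (no_types, lifting) mult_zero_right sum.neutral)
  hence *: "card (\<sigma> - {x}) = card \<tau>" "(\<sigma> - {x}, \<tau>) \<in> R\<^sup>*"
    using path_sum_reach by (auto simp: flow_def split: if_splits)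
  show "card \<sigma> = Suc (card \<tau>)"
    using card_Suc_Diff1[OF finite_cell[OF assms(1)] x(1)] *(1) by simp
  show "mono_dvd (lcm_mono \<tau>) (lcm_mono \<sigma>)"
    using reach_lcm[OF *(2)] lcm_mono_mono[OF assms(1), of "\<sigma> - {x}"] mono_dvd_trans by blast
qed

lemma B_iff: "\<sigma> \<in> B r \<longleftrightarrow> \<sigma> \<in> critical S A \<and> card \<sigma> = r"
  by (simp add: critical_cells_def)

lemma B_cell: "\<sigma> \<in> B r \<Longrightarrow> \<sigma> \<subseteq> S"
  by (simp add: B_iff critical_def)

lemma finite_B: "finite (B r)"
  by (rule finite_subset[of _ "Pow S"]) (use B_cell finite_vertices in auto)

lemma lookup_morse_boundary:
  assumes \<sigma>: "\<sigma> \<subseteq> S" "card \<sigma> = Suc q"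
  shows "lk (morse_boundary S v A (Suc q) \<sigma> :: _ \<Rightarrow>\<^sub>0 ('n, 'k::field) mpoly) \<tau> =
    (if \<tau> \<in> B q then of_int (coeff \<sigma> \<tau>) * mpow (lcm_mono \<sigma> - lcm_mono \<tau>) else 0)"
proof -
  let ?m = "mpow (lcm_mono \<sigma> - lcm_mono \<tau>) :: ('n, 'k) mpoly"
  have inner: "lk (\<Sum>\<sigma>''\<in>B q. \<Sum>P\<in>gradient_paths S A \<sigma>' \<sigma>''. Poly_Mapping.single \<sigma>''
      (of_int (path_weight v A P) * mpow (lcm_mono \<sigma> - lcm_mono \<sigma>''))) \<tau> =
      (if \<tau> \<in> B q then of_int (path_sum v \<sigma>' \<tau>) * ?m else 0)" for \<sigma>'
  proof -
    have "lk (\<Sum>\<sigma>''\<in>B q. \<Sum>P\<in>gradient_paths S A \<sigma>' \<sigma>''. Poly_Mapping.single \<sigma>''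
        (of_int (path_weight v A P) * mpow (lcm_mono \<sigma> - lcm_mono \<sigma>''))) \<tau> =
        (\<Sum>\<sigma>''\<in>B q. if \<sigma>'' = \<tau> then of_int (path_sum v \<sigma>' \<tau>) * ?m else 0)"
      unfolding lookup_sum
      by (rule sum.cong) (auto simp: lookup_single when_def path_sum_def sum_distrib_right)
    thus ?thesis using finite_B by simp
  qed
  have fin: "finite \<sigma>" using \<sigma>(1) finite_cell by blast
  have facets: "{\<sigma>'. \<sigma>' \<subseteq> \<sigma> \<and> card \<sigma>' = Suc q - 1} = (\<lambda>x. \<sigma> - {x}) ` \<sigma>"
  proof (intro set_eqI iffI)
    fix \<sigma>' assume *: "\<sigma>' \<in> {\<sigma>'. \<sigma>' \<subseteq> \<sigma> \<and> card \<sigma>' = Suc q - 1}"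
    moreover from this have "finite \<sigma>'" using fin finite_subset by blast
    ultimately have "card (\<sigma> - \<sigma>') = 1" using \<sigma>(2) by (simp add: card_Diff_subset)
    then obtain x where "\<sigma> - \<sigma>' = {x}" by (auto simp: card_1_singleton_iff)
    thus "\<sigma>' \<in> (\<lambda>x. \<sigma> - {x}) ` \<sigma>" using * by blast
  qed (use fin \<sigma>(2) in \<open>auto simp: card_Diff_singleton\<close>)
  show ?thesis
  proof (cases "\<tau> \<in> B q")
    case True
    have "lk (morse_boundary S v A (Suc q) \<sigma> :: _ \<Rightarrow>\<^sub>0 ('n, 'k) mpoly) \<tau> =
        (\<Sum>\<sigma>'\<in>(\<lambda>x. \<sigma> - {x}) ` \<sigma>. of_int (incidence v \<sigma> \<sigma>') * (of_int (path_sum v \<sigma>' \<tau>) * ?m))"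
      unfolding morse_boundary_def facets using True by (simp add: lookup_sum_smul inner)
    also have "\<dots> = (\<Sum>x\<in>\<sigma>. of_int (incidence v \<sigma> (\<sigma> - {x})) * (of_int (path_sum v (\<sigma> - {x}) \<tau>) * ?m))"
      by (subst sum.reindex) (auto simp: inj_on_def)
    also have "\<dots> = (\<Sum>x\<in>\<sigma>. of_int (vsign v x (\<sigma> - {x}) * flow v (\<sigma> - {x}) \<tau>) * ?m)"
    proof (rule sum.cong[OF refl])
      fix x assume x: "x \<in> \<sigma>"
      have "card (\<sigma> - {x}) = card \<tau>" using x fin \<sigma>(2) True by (simp add: B_iff card_Diff_singleton)
      thus "of_int (incidence v \<sigma> (\<sigma> - {x})) * (of_int (path_sum v (\<sigma> - {x}) \<tau>) * ?m) =
          of_int (vsign v x (\<sigma> - {x}) * flow v (\<sigma> - {x}) \<tau>) * ?m"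
        using x by (simp add: incidence_remove flow_def mult.assoc)
    qed
    finally show ?thesis using True by (simp add: morse_coeff_def sum_distrib_right)
  next
    case False
    thus ?thesis unfolding morse_boundary_def by (simp add: lookup_sum_smul inner)
  qed
qed

abbreviation d :: "nat \<Rightarrow> ('n monomial set \<Rightarrow>\<^sub>0 ('n, 'k::field) mpoly) \<Rightarrow> _" where
  "d \<equiv> morse_differential S v A"

lemma lookup_differential:
  fixes x :: "'n monomial set \<Rightarrow>\<^sub>0 ('n, 'k::field) mpoly"
  assumes x: "x \<in> free_module (B (Suc q))"
  shows "lk (d (Suc q) x) \<tau> = (if \<tau> \<in> B q then
    \<Sum>\<sigma>\<in>B (Suc q). lk x \<sigma> * (of_int (coeff \<sigma> \<tau>) * mpow (lcm_mono \<sigma> - lcm_mono \<tau>)) else 0)"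
proof -
  have keys: "Poly_Mapping.keys x \<subseteq> B (Suc q)" using x by (simp add: free_module_def)
  have "lk (d (Suc q) x) \<tau> =
      (\<Sum>\<sigma>\<in>Poly_Mapping.keys x. lk x \<sigma> * lk (morse_boundary S v A (Suc q) \<sigma>) \<tau>)"
    by (simp add: morse_differential_def lookup_sum)
  also have "\<dots> = (\<Sum>\<sigma>\<in>B (Suc q). lk x \<sigma> * lk (morse_boundary S v A (Suc q) \<sigma>) \<tau>)"
    by (rule sum.mono_neutral_left) (use keys finite_B in \<open>auto simp: in_keys_iff\<close>)
  also have "\<dots> = (\<Sum>\<sigma>\<in>B (Suc q). lk x \<sigma> * (if \<tau> \<in> B q then
      of_int (coeff \<sigma> \<tau>) * mpow (lcm_mono \<sigma> - lcm_mono \<tau>) else 0))"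
  proof (rule sum.cong[OF refl])
    fix \<sigma> assume "\<sigma> \<in> B (Suc q)"
    hence "\<sigma> \<subseteq> S" "card \<sigma> = Suc q" by (auto simp: B_cell B_iff)
    thus "lk x \<sigma> * lk (morse_boundary S v A (Suc q) \<sigma>) \<tau> = lk x \<sigma> * (if \<tau> \<in> B q then
        of_int (coeff \<sigma> \<tau>) * mpow (lcm_mono \<sigma> - lcm_mono \<tau>) else 0)"
      by (simp add: lookup_morse_boundary)
  qed
  finally show ?thesis by simp
qed

text \<open>The coefficient of \<open>x\<^sup>a / lcm \<sigma>\<close> in the \<open>\<sigma>\<close>-component of \<open>x\<close>. For fixed \<open>a\<close> this is the homogeneous part of
  \<open>x\<close> of degree \<open>a\<close>, as a chain with coefficients in the field.\<close>

definition strand ::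
  "('n monomial set \<Rightarrow>\<^sub>0 ('n, 'k::field) mpoly) \<Rightarrow> 'n monomial \<Rightarrow> 'n monomial set \<Rightarrow> 'k" where
  "strand x a \<sigma> = (if mono_dvd (lcm_mono \<sigma>) a then lk (lk x \<sigma>) (a - lcm_mono \<sigma>) else 0)"

lemma strand_shift: "strand x (b + lcm_mono \<sigma>) \<sigma> = lk (lk x \<sigma>) b"
  by (simp add: strand_def mono_dvd_add)

lemma strand_eqI: "(\<And>a \<sigma>. strand x a \<sigma> = strand y a \<sigma>) \<Longrightarrow> x = y"
  using strand_shift by (metis poly_mapping_eqI)

lemma strand_zero [simp]: "strand 0 a \<sigma> = 0"
  by (simp add: strand_def)

lemma strand_support:
  assumes "x \<in> free_module (B r)" "strand x a \<sigma> \<noteq> 0"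
  shows "\<sigma> \<in> B r" "\<sigma> \<in> crit_below a"
proof -
  show B: "\<sigma> \<in> B r" 
  proof (rule ccontr)
    assume "\<sigma> \<notin> B r"
    hence "lk x \<sigma> = 0" by (rule free_moduleD[OF assms(1)])
    thus False using assms(2) by (simp add: strand_def split: if_splits)
  qed
  have "mono_dvd (lcm_mono \<sigma>) a" using assms(2) by (auto simp: strand_def split: if_splits)
  thus "\<sigma> \<in> crit_below a"
    using B subset_below_iff[OF B_cell[OF B]] by (simp add: critical_below B_iff)
qed

lemma strand_chain: "x \<in> free_module (B r) \<Longrightarrow> chain_on (crit_below a) (strand x a)"
  using strand_support(2) by (auto simp: chain_on_def)

lemma finite_crit_below: "finite (crit_below a)"
  by (rule finite_subset[of _ "Pow S"]) (auto simp: critical_below critical_def[of S A] finite_vertices)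

text \<open>The monomial factors of the differential keep the total degree, so on the strand of degree \<open>a\<close> only
  the integer coefficients remain.\<close>

lemma strand_differential:
  fixes x :: "'n monomial set \<Rightarrow>\<^sub>0 ('n, 'k::field) mpoly"
  assumes x: "x \<in> free_module (B (Suc q))"
  shows "strand (d (Suc q) x) a \<tau> = (if \<tau> \<in> crit_below a then bd_below a (strand x a) \<tau> else 0)"
proof (cases "\<tau> \<in> crit_below a \<and> \<tau> \<in> B q")
  case False
  have "strand (d (Suc q) x) a \<tau> = 0"
  proof (cases "\<tau> \<in> B q")
    case True
    hence "\<not> mono_dvd (lcm_mono \<tau>) a"
      using False subset_below_iff[OF B_cell[OF True]] by (simp add: critical_below B_iff)
    thus ?thesis by (simp add: strand_def)
  qed (simp add: strand_def lookup_differential[OF x])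
  moreover have "bd_below a (strand x a) \<tau> = 0" if \<tau>: "\<tau> \<in> crit_below a"
    unfolding bd_below_eq
  proof (rule sum.neutral, rule ballI, rule ccontr)
    fix \<sigma> assume "of_int (coeff \<sigma> \<tau>) * strand x a \<sigma> \<noteq> 0"
    hence "coeff \<sigma> \<tau> \<noteq> 0" "\<sigma> \<in> B (Suc q)" using strand_support(1)[OF x] by auto
    hence "card \<tau> = q" using coeff_nonzero(1)[of \<sigma> \<tau>] B_cell by (auto simp: B_iff)
    thus False using False \<tau> by (simp add: B_iff critical_below)
  qed
  ultimately show ?thesis by simp
next
  case True
  hence \<tau>: "\<tau> \<in> B q" "mono_dvd (lcm_mono \<tau>) a" "card \<tau> = q"
    using subset_below_iff[of \<tau> a] B_cell by (auto simp: critical_below B_iff)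
  have summand: "lk (lk x \<sigma> * (of_int (coeff \<sigma> \<tau>) * mpow (lcm_mono \<sigma> - lcm_mono \<tau>))) (a - lcm_mono \<tau>) =
      of_int (coeff \<sigma> \<tau>) * strand x a \<sigma>" if \<sigma>: "\<sigma> \<in> B (Suc q)" for \<sigma>
  proof (cases "coeff \<sigma> \<tau> = 0")
    case False
    let ?b = "lcm_mono \<sigma> - lcm_mono \<tau>"
    have dvd: "mono_dvd (lcm_mono \<tau>) (lcm_mono \<sigma>)" using coeff_nonzero(2)[OF B_cell[OF \<sigma>] False] .
    have "mono_dvd ?b (a - lcm_mono \<tau>) \<longleftrightarrow> mono_dvd (lcm_mono \<sigma>) a"
      using dvd \<tau>(2) unfolding mono_dvd_def lookup_minus
      by (intro iff_allI) (metis diff_le_mono le_diff_iff)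
    moreover have "a - lcm_mono \<tau> - ?b = a - lcm_mono \<sigma>"
      using dvd by (intro poly_mapping_eqI) (simp add: lookup_minus mono_dvd_def)
    moreover have eq: "lk x \<sigma> * (of_int (coeff \<sigma> \<tau>) * mpow ?b) = of_int (coeff \<sigma> \<tau>) * (lk x \<sigma> * mpow ?b)"
      by (simp add: algebra_simps)
    ultimately show ?thesis unfolding eq lookup_of_int_mult lookup_mult_mpow by (simp add: strand_def)
  qed simp
  have "strand (d (Suc q) x) a \<tau> = (\<Sum>\<sigma>\<in>B (Suc q). of_int (coeff \<sigma> \<tau>) * strand x a \<sigma>)"
    using \<tau> summand by (simp add: strand_def[of "d (Suc q) x"] lookup_differential[OF x] lookup_sum)
  also have "\<dots> = (\<Sum>\<sigma>\<in>B (Suc q) \<inter> crit_below a. of_int (coeff \<sigma> \<tau>) * strand x a \<sigma>)"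
    by (rule sum.mono_neutral_right) (use finite_B strand_support(2)[OF x] in auto)
  also have "\<dots> = bd_below a (strand x a) \<tau>"
    unfolding bd_below_eq
    by (rule sum.mono_neutral_left) (use finite_crit_below strand_support(1)[OF x] in auto)
  finally show ?thesis using True by simp
qed

lemma strand_assemble:
  fixes e :: "'n monomial \<Rightarrow> 'n monomial set \<Rightarrow> 'k::field"
  assumes M: "finite M" "\<And>a \<sigma>. e a \<sigma> \<noteq> 0 \<Longrightarrow> a \<in> M"
    and e: "\<And>a \<sigma>. e a \<sigma> \<noteq> 0 \<Longrightarrow> \<sigma> \<in> B r \<and> mono_dvd (lcm_mono \<sigma>) a"
  obtains y where "y \<in> free_module (B r)" "\<And>a \<sigma>. strand y a \<sigma> = e a \<sigma>"
proof -
  define y where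
    "y = (\<Sum>a\<in>M. \<Sum>\<sigma>\<in>B r. Poly_Mapping.single \<sigma> (Poly_Mapping.single (a - lcm_mono \<sigma>) (e a \<sigma>)))"
  have y: "lk y \<sigma> = (if \<sigma> \<in> B r then \<Sum>a\<in>M. Poly_Mapping.single (a - lcm_mono \<sigma>) (e a \<sigma>) else 0)" for \<sigma>
    using finite_B by (simp add: y_def lookup_sum lookup_single when_def)
  show thesis
  proof (rule that[of y])
    show "y \<in> free_module (B r)" by (auto simp: free_module_def in_keys_iff y split: if_splits)
    fix a \<sigma>
    show "strand y a \<sigma> = e a \<sigma>"
    proof (cases "\<sigma> \<in> B r \<and> mono_dvd (lcm_mono \<sigma>) a")
      case True
      have "strand y a \<sigma> = (\<Sum>a'\<in>M. e a' \<sigma> when a' - lcm_mono \<sigma> = a - lcm_mono \<sigma>)"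
        using True by (simp add: strand_def y lookup_sum lookup_single)
      also have "\<dots> = (\<Sum>a'\<in>M. if a' = a then e a \<sigma> else 0)"
      proof (rule sum.cong[OF refl])
        fix a'
        have "a' = a" if "e a' \<sigma> \<noteq> 0" "a' - lcm_mono \<sigma> = a - lcm_mono \<sigma>"
          using mono_dvd_diff_add e[OF that(1)] True that(2) by metis
        thus "(e a' \<sigma> when a' - lcm_mono \<sigma> = a - lcm_mono \<sigma>) = (if a' = a then e a \<sigma> else 0)"
          by (auto simp: when_def)
      qed
      also have "\<dots> = e a \<sigma>" using M by auto
      finally show ?thesis .
    next
      case False
      thus ?thesis using e[of a \<sigma>] by (auto simp: strand_def y)
    qed
  qed
qed

lemma finite_strands:
  "finite {a. \<exists>\<sigma>. strand x a \<sigma> \<noteq> 0}"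
proof (rule finite_subset)
  show "{a. \<exists>\<sigma>. strand x a \<sigma> \<noteq> 0} \<subseteq>
      (\<Union>\<sigma>\<in>Poly_Mapping.keys x. (\<lambda>b. b + lcm_mono \<sigma>) ` Poly_Mapping.keys (lk x \<sigma>))"
  proof
    fix a assume "a \<in> {a. \<exists>\<sigma>. strand x a \<sigma> \<noteq> 0}"
    then obtain \<sigma> where "strand x a \<sigma> \<noteq> 0" by blast
    hence \<sigma>: "mono_dvd (lcm_mono \<sigma>) a" "a - lcm_mono \<sigma> \<in> Poly_Mapping.keys (lk x \<sigma>)"
      by (auto simp: strand_def in_keys_iff split: if_splits)
    hence "\<sigma> \<in> Poly_Mapping.keys x" by (auto simp: in_keys_iff)
    thus "a \<in> (\<Union>\<sigma>\<in>Poly_Mapping.keys x. (\<lambda>b. b + lcm_mono \<sigma>) ` Poly_Mapping.keys (lk x \<sigma>))"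
      using \<sigma> mono_dvd_diff_add[OF \<sigma>(1)] by force
  qed
qed auto

text \<open>Exactness holds strand by strand. The preimages found in each degree are first truncated to the
  cells of the right cardinality, which is harmless as the differential lowers cardinality by one, and
  are then assembled; only finitely many strands of \<open>x\<close> are nonzero.\<close>

lemma boundary_if_strands_cycles:
  fixes x :: "'n monomial set \<Rightarrow>\<^sub>0 ('n, 'k::field) mpoly"
  assumes x: "x \<in> free_module (B r)"
    and nonempty: "\<And>a \<sigma>. strand x a \<sigma> \<noteq> 0 \<Longrightarrow> below a \<noteq> {}"
    and cycle: "\<And>a \<tau>. \<tau> \<in> crit_below a \<Longrightarrow> bd_below a (strand x a) \<tau> = 0"
  shows "x \<in> d (Suc r) ` free_module (B (Suc r))"
proof -
  define Q where "Q a e \<longleftrightarrow>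
    (\<forall>\<sigma>. e \<sigma> \<noteq> 0 \<longrightarrow> \<sigma> \<in> crit_below a \<and> \<sigma> \<in> B (Suc r) \<and> (\<exists>\<tau>. strand x a \<tau> \<noteq> 0)) \<and>
    (\<forall>\<tau>\<in>crit_below a. bd_below a e \<tau> = strand x a \<tau>)" for a e
  have ex: "\<exists>e. Q a e" for a
  proof (cases "\<exists>\<tau>. strand x a \<tau> \<noteq> 0")
    case False
    thus ?thesis by (intro exI[of _ "\<lambda>_. 0"]) (simp add: Q_def bd_below_eq)
  next
    case True
    interpret b: morse_complex "below a" "A_below a" v "flow v" by (rule below_complex)
    have "below a \<noteq> {}" using True nonempty by blast
    from b.morse_complex_exact[OF this strand_chain[OF x] cycle]
    obtain e where e: "chain_on (crit_below a) e" "\<And>\<tau>. \<tau> \<in> crit_below a \<Longrightarrow> bd_below a e \<tau> = strand x a \<tau>"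
      by metis
    define e' where "e' \<sigma> = (if card \<sigma> = Suc r then e \<sigma> else 0)" for \<sigma>
    have "bd_below a e' \<tau> = strand x a \<tau>" if \<tau>: "\<tau> \<in> crit_below a" for \<tau>
    proof (cases "card \<tau> = r")
      case True
      have "bd_below a e' \<tau> = bd_below a e \<tau>"
        unfolding bd_below_eq
      proof (rule sum.cong[OF refl])
        fix \<sigma> assume "\<sigma> \<in> crit_below a"
        hence "\<sigma> \<subseteq> S" by (simp add: critical_below critical_def[of S A])
        thus "of_int (coeff \<sigma> \<tau>) * e' \<sigma> = of_int (coeff \<sigma> \<tau>) * e \<sigma>"
          using coeff_nonzero(1)[of \<sigma> \<tau>] True by (cases "coeff \<sigma> \<tau> = 0") (auto simp: e'_def)
      qed
      thus ?thesis using e(2)[OF \<tau>] by simp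
    next
      case False
      have "bd_below a e' \<tau> = 0"
        unfolding bd_below_eq
      proof (rule sum.neutral, rule ballI)
        fix \<sigma> assume "\<sigma> \<in> crit_below a"
        hence "\<sigma> \<subseteq> S" by (simp add: critical_below critical_def[of S A])
        thus "of_int (coeff \<sigma> \<tau>) * e' \<sigma> = 0"
          using coeff_nonzero(1)[of \<sigma> \<tau>] False by (cases "coeff \<sigma> \<tau> = 0") (auto simp: e'_def)
      qed
      moreover have "strand x a \<tau> = 0" using strand_support(1)[OF x] False by (auto simp: B_iff)
      ultimately show ?thesis by simp
    qed
    moreover have "\<sigma> \<in> crit_below a \<and> \<sigma> \<in> B (Suc r)" if "e' \<sigma> \<noteq> 0" for \<sigma>
    proof -
      have "card \<sigma> = Suc r" "e \<sigma> \<noteq> 0" using that by (auto simp: e'_def split: if_splits)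
      moreover from this have "\<sigma> \<in> crit_below a" using chain_onD[OF e(1)] by blast
      ultimately show ?thesis by (simp add: B_iff critical_below)
    qed
    ultimately have "Q a e'" using True unfolding Q_def by simp
    thus ?thesis by blast
  qed
  obtain e where "\<And>a. Q a (e a)" using choice[of Q] ex by blast
  hence e: "\<And>a \<sigma>. e a \<sigma> \<noteq> 0 \<Longrightarrow> \<sigma> \<in> crit_below a \<and> \<sigma> \<in> B (Suc r) \<and> (\<exists>\<tau>. strand x a \<tau> \<noteq> 0)"
    "\<And>a \<tau>. \<tau> \<in> crit_below a \<Longrightarrow> bd_below a (e a) \<tau> = strand x a \<tau>"
    unfolding Q_def by blast+
  have dvd: "mono_dvd (lcm_mono \<sigma>) a" if "\<sigma> \<in> crit_below a" for \<sigma> a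
    using that subset_below_iff[of \<sigma> a] by (simp add: critical_below critical_def[of S A])
  obtain y where y: "y \<in> free_module (B (Suc r))" "\<And>a \<sigma>. strand y a \<sigma> = e a \<sigma>"
    using strand_assemble[OF finite_strands[of x], of e "Suc r"] e(1) dvd by blast
  have "d (Suc r) y = x"
  proof (rule strand_eqI)
    fix a \<tau>
    have "strand y a = e a" using y(2) by auto
    hence "strand (d (Suc r) y) a \<tau> = (if \<tau> \<in> crit_below a then strand x a \<tau> else 0)"
      using strand_differential[OF y(1)] e(2) by simp
    also have "\<dots> = strand x a \<tau>" using strand_support(2)[OF x, of a \<tau>] by auto
    finally show "strand (d (Suc r) y) a \<tau> = strand x a \<tau>" .
  qed
  thus ?thesis using y(1) by blast
qed

lemma differential_in_free_module:
  assumes "x \<in> free_module (B (Suc q))" shows "d (Suc q) x \<in> free_module (B q)"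
  by (auto simp: free_module_def in_keys_iff lookup_differential[OF assms] split: if_splits)

lemma differential_differential:
  fixes x :: "'n monomial set \<Rightarrow>\<^sub>0 ('n, 'k::field) mpoly"
  assumes x: "x \<in> free_module (B (Suc (Suc q)))"
  shows "d (Suc q) (d (Suc (Suc q)) x) = 0"
proof (rule strand_eqI)
  fix a \<tau>
  interpret b: morse_complex "below a" "A_below a" v "flow v" by (rule below_complex)
  have "bd_below a (strand (d (Suc (Suc q)) x) a) \<tau> = bd_below a (bd_below a (strand x a)) \<tau>"
    by (rule b.morse_bd_cong) (simp add: strand_differential[OF x])
  thus "strand (d (Suc q) (d (Suc (Suc q)) x)) a \<tau> = strand 0 a \<tau>"
    using strand_differential[OF differential_in_free_module[OF x]]
      b.morse_bd_morse_bd[OF strand_chain[OF x]] by simp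
qed

lemma differential_add:
  assumes "x \<in> free_module (B (Suc q))" "y \<in> free_module (B (Suc q))"
  shows "d (Suc q) (x + y) = d (Suc q) x + d (Suc q) y"
  by (rule poly_mapping_eqI)
    (simp add: lookup_differential assms free_module_add lookup_add distrib_right sum.distrib)

lemma differential_smul:
  assumes "x \<in> free_module (B (Suc q))"
  shows "d (Suc q) (smul c x) = smul c (d (Suc q) x)"
  by (rule poly_mapping_eqI)
    (simp add: lookup_differential assms free_module_smul sum_distrib_left mult.assoc)

text \<open>In this form it is visible that the differential preserves homogeneity, since it acts strand by strand.\<close>

lemma homog_elem_iff_strands:
  "homog_elem (\<lambda>\<sigma>. expvec (lcm_mono \<sigma>)) \<delta> x \<longleftrightarrow> (\<forall>a \<sigma>. strand x a \<sigma> \<noteq> 0 \<longrightarrow> expvec a = \<delta>)"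
proof
  assume h: "homog_elem (\<lambda>\<sigma>. expvec (lcm_mono \<sigma>)) \<delta> x"
  show "\<forall>a \<sigma>. strand x a \<sigma> \<noteq> 0 \<longrightarrow> expvec a = \<delta>"
  proof (intro allI impI)
    fix a \<sigma> assume "strand x a \<sigma> \<noteq> 0"
    hence \<sigma>: "mono_dvd (lcm_mono \<sigma>) a" "a - lcm_mono \<sigma> \<in> Poly_Mapping.keys (lk x \<sigma>)"
      by (auto simp: strand_def in_keys_iff split: if_splits)
    have "expvec (a - lcm_mono \<sigma>) = (\<lambda>i. \<delta> i - expvec (lcm_mono \<sigma>) i)"
      using h \<sigma>(2) by (auto simp: homog_elem_def homog_poly_def)
    thus "expvec a = \<delta>"
      using expvec_add[of "a - lcm_mono \<sigma>" "lcm_mono \<sigma>"] mono_dvd_diff_add[OF \<sigma>(1)] by simp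
  qed
next
  assume h: "\<forall>a \<sigma>. strand x a \<sigma> \<noteq> 0 \<longrightarrow> expvec a = \<delta>"
  show "homog_elem (\<lambda>\<sigma>. expvec (lcm_mono \<sigma>)) \<delta> x"
    unfolding homog_elem_def homog_poly_def
  proof (intro allI ballI)
    fix \<sigma> b assume "b \<in> Poly_Mapping.keys (lk x \<sigma>)"
    hence "expvec (b + lcm_mono \<sigma>) = \<delta>" using h strand_shift[of x b \<sigma>] by (metis in_keys_iff)
    thus "expvec b = (\<lambda>i. \<delta> i - expvec (lcm_mono \<sigma>) i)" by (auto simp: expvec_add)
  qed
qed

lemma differential_homogeneous:
  assumes x: "x \<in> free_module (B (Suc q))"
    and h: "homog_elem (\<lambda>\<sigma>. expvec (lcm_mono \<sigma>)) \<delta> x"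
  shows "homog_elem (\<lambda>\<sigma>. expvec (lcm_mono \<sigma>)) \<delta> (d (Suc q) x)"
  unfolding homog_elem_iff_strands
proof (intro allI impI)
  fix a \<tau> assume "strand (d (Suc q) x) a \<tau> \<noteq> 0"
  hence "bd_below a (strand x a) \<tau> \<noteq> 0" by (auto simp: strand_differential[OF x] split: if_splits)
  then obtain \<sigma> where "strand x a \<sigma> \<noteq> 0"
    unfolding bd_below_eq by (metis (no_types, lifting) mult_zero_right sum.neutral)
  thus "expvec a = \<delta>" using h homog_elem_iff_strands by blast
qed

text \<open>The degenerate case \<open>I = R\<close>: the empty cell has lcm 1, so a cell matched with it consists of the
  generator 1.\<close>

lemma empty_cell_matched:
  assumes "{} \<notin> critical S A" shows "below a \<noteq> {}"
proof -
  obtain \<sigma> where A: "(\<sigma>, {}) \<in> A"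
    using assms edgeD(3)[of "{}"] by (auto simp: critical_def Field_def)
  have "mono_dvd (lcm_mono \<sigma>) a" using lcm_preserved[OF A] by (simp add: mono_dvd_def)
  hence "\<sigma> \<subseteq> below a" using subset_below_iff edgeD(1)[OF A] by simp
  moreover have "\<sigma> \<noteq> {}" using edgeD(3)[OF A] by auto
  ultimately show ?thesis by auto
qed

lemma B_0: "B 0 \<subseteq> {{}}"
proof
  fix \<sigma> assume "\<sigma> \<in> B 0"
  hence "finite \<sigma>" "card \<sigma> = 0" using B_cell finite_cell by (blast, simp add: B_iff)
  thus "\<sigma> \<in> {{}}" by simp
qed

text \<open>The augmentation reads off the coefficient of the empty cell. An element of its kernel has, by
  definition of \<open>I\<close>, only strands whose simplex is nonempty; these are cycles since the empty cell has
  no facets, hence boundaries.\<close>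

theorem resolution:
  fixes I :: "('n, 'k::field) mpoly set"
  assumes ideal: "module.subspace (*) I"
    and I: "\<And>p. p \<in> I \<longleftrightarrow> (\<forall>a\<in>Poly_Mapping.keys p. below a \<noteq> {})"
  shows "graded_free_resolution I B (\<lambda>\<sigma>. expvec (lcm_mono \<sigma>)) d"
proof -
  let ?F = "\<lambda>r. free_module (B r) :: ('n monomial set \<Rightarrow>\<^sub>0 ('n, 'k) mpoly) set"
  have exact: "{x \<in> ?F (Suc r). d (Suc r) x = 0} = d (Suc (Suc r)) ` ?F (Suc (Suc r))" for r
  proof (intro equalityI subsetI)
    fix x assume "x \<in> {x \<in> ?F (Suc r). d (Suc r) x = 0}"
    hence x: "x \<in> ?F (Suc r)" "d (Suc r) x = 0" by auto
    show "x \<in> d (Suc (Suc r)) ` ?F (Suc (Suc r))"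
    proof (rule boundary_if_strands_cycles[OF x(1)])
      fix a \<sigma> assume "strand x a \<sigma> \<noteq> 0"
      from strand_support[OF x(1) this] show "below a \<noteq> {}"
        by (auto simp: B_iff critical_below)
    next
      fix a \<tau> assume "\<tau> \<in> crit_below a"
      thus "bd_below a (strand x a) \<tau> = 0"
        using strand_differential[OF x(1), of a \<tau>] x(2) by simp
    qed
  qed (use differential_in_free_module differential_differential in auto)
  define \<epsilon> :: "('n monomial set \<Rightarrow>\<^sub>0 ('n, 'k) mpoly) \<Rightarrow> _" where "\<epsilon> x = coset I (lk x {})" for x
  have surj: "\<epsilon> ` ?F 0 = range (coset I)"
  proof (cases "{} \<in> critical S A")
    case True
    have "coset I p \<in> \<epsilon> ` ?F 0" for p
    proof (rule image_eqI)
      show "coset I p = \<epsilon> (Poly_Mapping.single {} p)" by (simp add: \<epsilon>_def)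
      show "Poly_Mapping.single {} p \<in> ?F 0" using True by (simp add: free_module_def B_iff)
    qed
    thus ?thesis by (auto simp: \<epsilon>_def)
  next
    case False
    \<comment> \<open>The free module in homological degree 0 is zero here, and so is \<open>R/I\<close>.\<close>
    hence "I = UNIV" using I empty_cell_matched by blast
    moreover have "0 \<in> ?F 0" by (simp add: free_module_def)
    ultimately show ?thesis by (auto simp: \<epsilon>_def coset_def)
  qed
  have kernel: "{x \<in> ?F 0. \<epsilon> x = coset I 0} = d (Suc 0) ` ?F (Suc 0)"
  proof (intro equalityI subsetI)
    fix x assume "x \<in> {x \<in> ?F 0. \<epsilon> x = coset I 0}"
    hence x: "x \<in> ?F 0" "lk x {} \<in> I" by (auto simp: \<epsilon>_def coset_eq_iff[OF ideal])
    show "x \<in> d (Suc 0) ` ?F (Suc 0)"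
    proof (rule boundary_if_strands_cycles[OF x(1)])
      fix a \<sigma> assume nz: "strand x a \<sigma> \<noteq> 0"
      hence "\<sigma> = {}" using strand_support(1)[OF x(1)] B_0 by blast
      hence "a \<in> Poly_Mapping.keys (lk x {})"
        using nz by (auto simp: strand_def in_keys_iff split: if_splits)
      thus "below a \<noteq> {}" using x(2) I by blast
    next
      fix a \<tau>
      have "of_int (coeff \<sigma> \<tau>) * strand x a \<sigma> = 0" for \<sigma>
        using strand_support(1)[OF x(1), of a \<sigma>] B_0 by (auto simp: morse_coeff_def)
      thus "bd_below a (strand x a) \<tau> = 0" unfolding bd_below_eq by (intro sum.neutral ballI)
    qed
  next
    fix x assume "x \<in> d (Suc 0) ` ?F (Suc 0)"
    then obtain y where y: "y \<in> ?F (Suc 0)" "x = d (Suc 0) y" by auto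
    \<comment> \<open>A nonzero coefficient of the empty cell comes from a nonempty critical cell in the same degree.\<close>
    have "below a \<noteq> {}" if "a \<in> Poly_Mapping.keys (lk x {})" for a
    proof -
      have "strand x a {} \<noteq> 0" using that by (simp add: strand_def mono_dvd_def in_keys_iff)
      hence "bd_below a (strand y a) {} \<noteq> 0"
        using strand_differential[OF y(1)] y(2) by (auto split: if_splits)
      then obtain \<sigma> where \<sigma>: "\<sigma> \<in> crit_below a" "coeff \<sigma> {} \<noteq> 0"
        unfolding bd_below_eq by (metis (no_types, lifting) mult_zero_left of_int_0 sum.neutral)
      hence "\<sigma> \<noteq> {}" by (auto simp: morse_coeff_def)
      thus ?thesis using \<sigma>(1) by (auto simp: critical_below)
    qed
    hence "lk x {} \<in> I" using I by blast
    thus "x \<in> {x \<in> ?F 0. \<epsilon> x = coset I 0}"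
      using y differential_in_free_module by (auto simp: \<epsilon>_def coset_eq_iff[OF ideal])
  qed
  have graded: "\<exists>p. homog_poly \<delta> p \<and> \<epsilon> x = coset I p"
    if h: "homog_elem (\<lambda>\<sigma>. expvec (lcm_mono \<sigma>)) \<delta> x" for \<delta> x
  proof (intro exI conjI)
    have "(\<lambda>i. \<delta> i - expvec (lcm_mono {}) i) = \<delta>" by (simp add: expvec_def)
    thus "homog_poly \<delta> (lk x {})" using h unfolding homog_elem_def by metis
  qed (simp add: \<epsilon>_def)
  have add: "\<epsilon> (x + y) = coset_add I (\<epsilon> x) (\<epsilon> y)" for x y
    by (simp add: \<epsilon>_def lookup_add coset_add_coset[OF ideal])
  have smul: "\<epsilon> (smul c x) = coset_smul I c (\<epsilon> x)" for c x
    by (simp add: \<epsilon>_def coset_smul_coset[OF ideal])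
  have image: "d (Suc r) ` ?F (Suc r) \<subseteq> ?F r" for r
    using differential_in_free_module by blast
  show ?thesis
    unfolding graded_free_resolution_def
    by (intro conjI allI ballI impI exI[of _ \<epsilon>] image exact surj kernel graded add smul
        differential_add differential_smul differential_homogeneous)
qed

end

section \<open>The Barile--Macchia matching\<close>

lemma rtrancl_leaves:
  assumes "(x, y) \<in> r\<^sup>*" "P x" "\<not> P y"
  obtains u w where "(x, u) \<in> r\<^sup>*" "(u, w) \<in> r" "(w, y) \<in> r\<^sup>*" "P u" "\<not> P w"
  using assms
proof (induction arbitrary: thesis rule: rtrancl_induct)
  case (step y z)
  show ?case
  proof (cases "P y")
    case True thus ?thesis using step.prems(1)[of y z] step.hyps step.prems(3) by blast
  next
    case False
    then obtain u w where "(x, u) \<in> r\<^sup>*" "(u, w) \<in> r" "(w, y) \<in> r\<^sup>*" "P u" "\<not> P w"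
      using step.IH step.prems(2) by metis
    thus ?thesis using step.prems(1) step.hyps(2) by (meson rtrancl.rtrancl_into_rtrancl)
  qed
qed simp

lemma finite_linear_order_least:
  assumes "linear_order_on S r" "finite S" "K \<subseteq> S" "K \<noteq> {}"
  obtains m where "m \<in> K" "\<And>k. k \<in> K \<Longrightarrow> (m, k) \<in> r"
proof -
  have r: "partial_order_on S r" "total_on S r" "r \<subseteq> S \<times> S" "refl_on S r"
    using assms(1) by (auto simp: linear_order_on_def partial_order_on_def preorder_on_def)
  have "finite r" using r(3) assms(2) finite_subset by blast
  hence "wf (r - Id)" using partial_order_on_well_order_on r(1) by blast
  then obtain m where m: "m \<in> K" "\<And>k. (k, m) \<in> r - Id \<Longrightarrow> k \<notin> K"
    using assms(4) wfE_min by (metis ex_in_conv)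
  have "(m, k) \<in> r" if "k \<in> K" for k
    using r(2,4) m that assms(3) unfolding total_on_def refl_on_def by (cases "k = m") blast+
  thus thesis using that m(1) by blast
qed

text \<open>The acyclicity argument in general form. The vertex \<open>key \<sigma>\<close> is the one that the matching removes from
  \<open>\<sigma>\<close>, and it is the least among all vertices that can be removed from \<open>\<sigma>\<close> without leaving its \<open>f\<close>-fibre.
  Instead of a single cycle the proof considers the whole strongly connected component \<open>Z\<close> of a point \<open>z\<close> on
  it. Since heights are constant on \<open>Z\<close>, a downward edge in \<open>Z\<close> always leads from a source to a target.\<close>

lemma (in matching) acyclic_if_smallest_removed:
  fixes f :: "'a set \<Rightarrow> 'p::order" and key :: "'a set \<Rightarrow> 'a"
  assumes lin: "\<And>p. linear_order_on S (ord p)"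
    and dec: "\<And>\<sigma> \<tau>. (\<sigma>, \<tau>) \<in> R \<Longrightarrow> f \<tau> \<le> f \<sigma>"
    and key: "\<And>\<sigma> \<tau>. (\<sigma>, \<tau>) \<in> A \<Longrightarrow> key \<sigma> \<in> \<sigma> \<and> \<tau> = \<sigma> - {key \<sigma>}"
    and smallest: "\<And>\<sigma> \<tau> x. (\<sigma>, \<tau>) \<in> A \<Longrightarrow> x \<in> \<sigma> \<Longrightarrow> f (\<sigma> - {x}) = f \<sigma> \<Longrightarrow> (key \<sigma>, x) \<in> ord (f \<sigma>)"
  shows "acyclic R"
  unfolding acyclic_def
proof (intro allI notI)
  fix z assume cyc: "(z, z) \<in> R\<^sup>+"
  define Z where "Z = {y. (z, y) \<in> R\<^sup>* \<and> (y, z) \<in> R\<^sup>*}"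
  define U where "U = {\<sigma> \<in> Z. \<exists>\<tau>\<in>Z. (\<sigma>, \<tau>) \<in> A}"
  have f_le: "f y \<le> f x" if "(x, y) \<in> R\<^sup>*" for x y
    using that by (induction rule: rtrancl_induct) (auto dest: dec intro: order_trans)
  have const: "f y = f z" "height y = height z" if "y \<in> Z" for y
    using that f_le height_reachable unfolding Z_def by (auto intro: antisym)
  have pred: "\<exists>w\<in>Z. (w, y) \<in> R" if "y \<in> Z" for y
  proof -
    have y: "(z, y) \<in> R\<^sup>*" "(y, z) \<in> R\<^sup>*" using that by (auto simp: Z_def)
    hence "(z, y) \<in> R\<^sup>+" using cyc by (meson rtrancl_trancl_trancl trancl_rtrancl_trancl)
    then obtain w where "(z, w) \<in> R\<^sup>*" "(w, y) \<in> R" by (metis tranclD2)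
    thus ?thesis using y(2) by (auto simp: Z_def intro: converse_rtrancl_into_rtrancl)
  qed
  have down_targets: "x \<in> Range A \<and> y \<notin> Range A"
    if "(y, x) \<in> R" "(x, y) \<notin> A" "x \<in> Z" "y \<in> Z" for x y
    using that(1)
  proof (cases rule: R_cases)
    case down
    have "height x = height y" using const that by simp
    thus ?thesis using down(3) by (auto simp: height_def split: if_splits)
  qed (use that in auto)
  have down_source: "y \<in> U" if yx: "(y, x) \<in> R" "(x, y) \<notin> A" "x \<in> Z" "y \<in> Z" for x y
  proof -
    obtain w where w: "w \<in> Z" "(w, y) \<in> R" using pred yx(4) by blast
    hence "(y, w) \<in> A" using down_targets[of w y] down_targets[of y x] yx by blast
    thus ?thesis using w yx(4) by (auto simp: U_def)
  qed
  have "U \<noteq> {}"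
  proof -
    have "z \<in> Z" by (simp add: Z_def)
    then obtain w where w: "w \<in> Z" "(w, z) \<in> R" using pred by blast
    thus ?thesis using down_source[of w z] \<open>z \<in> Z\<close> by (cases "(z, w) \<in> A") (auto simp: U_def)
  qed
  moreover have "key ` U \<subseteq> S" using key edgeD(1) by (fastforce simp: U_def)
  \<comment> \<open>The least vertex that is ever inserted by an upward edge of \<open>Z\<close>.\<close>
  ultimately obtain m where m: "m \<in> key ` U" "\<And>k. k \<in> key ` U \<Longrightarrow> (m, k) \<in> ord (f z)"
    using finite_linear_order_least[OF lin finite_vertices] by (metis image_is_empty)
  then obtain \<sigma> \<tau> where \<sigma>: "\<sigma> \<in> Z" "\<tau> \<in> Z" "(\<sigma>, \<tau>) \<in> A" "m = key \<sigma>" by (auto simp: U_def)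
  have "m \<in> \<sigma>" "m \<notin> \<tau>" using key[OF \<sigma>(3)] \<sigma>(4) by auto
  moreover have "(\<sigma>, \<tau>) \<in> R\<^sup>*" using \<sigma>(1,2) by (auto simp: Z_def)
  \<comment> \<open>As \<open>m\<close> is inserted on the way from \<open>\<tau>\<close> to \<open>\<sigma>\<close>, it is removed somewhere on the way back.\<close>
  ultimately obtain y x where yx: "(\<sigma>, y) \<in> R\<^sup>*" "(y, x) \<in> R" "(x, \<tau>) \<in> R\<^sup>*" "m \<in> y" "m \<notin> x"
    using rtrancl_leaves[of \<sigma> \<tau> R "\<lambda>s. m \<in> s"] by blast
  have Z: "y \<in> Z" "x \<in> Z"
    using yx(1-3) \<sigma>(1,2) unfolding Z_def
    by (auto intro: rtrancl_trans converse_rtrancl_into_rtrancl rtrancl_into_rtrancl)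
  have notup: "(x, y) \<notin> A" using edgeD(2) yx(4,5) by blast
  hence "y \<in> U" using down_source yx(2) Z by blast
  then obtain \<rho> where \<rho>: "(y, \<rho>) \<in> A" by (auto simp: U_def)
  have "x = y - {m} \<and> (y, x) \<notin> A"
    using yx(2)
  proof (cases rule: R_cases)
    case down
    have "finite y" using edgeD(4)[OF \<rho>] .
    hence "card (y - {m}) = card x" using down(3) yx(4) by simp
    moreover have "x \<subseteq> y - {m}" using down(2) yx(5) by auto
    ultimately show ?thesis using down(4) \<open>finite y\<close> by (metis card_subset_eq finite_Diff)
  qed (use notup in auto)
  hence x: "x = y - {m}" and notA: "(y, x) \<notin> A" by auto
  have "f (y - {m}) = f y" using const Z x by metis
  hence "(key y, m) \<in> ord (f z)" using smallest[OF \<rho> yx(4)] const Z by metis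
  moreover have "(m, key y) \<in> ord (f z)" using m(2) \<open>y \<in> U\<close> by blast
  moreover have "antisym (ord (f z))"
    using lin by (simp add: linear_order_on_def partial_order_on_def)
  ultimately have "key y = m" by (auto dest: antisymD)
  thus False using notA key[OF \<rho>] \<rho> x by metis
qed

lemma sb_cases:
  assumes "linear_order_on S r" "\<sigma> \<subseteq> S" "sb r \<sigma> \<noteq> {}"
  obtains m where "sb r \<sigma> = {m}" "m \<in> \<sigma>" "\<And>x. x \<in> bridges \<sigma> \<Longrightarrow> (m, x) \<in> r"
proof -
  obtain m where m: "m \<in> sb r \<sigma>" using assms(3) by auto
  have "antisym r" using assms(1) by (simp add: linear_order_on_def partial_order_on_def)
  hence "sb r \<sigma> = {m}" using m by (auto simp: sb_def dest: antisymD)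
  thus thesis using that m by (auto simp: sb_def bridges_def)
qed

text \<open>Cells are processed by decreasing cardinality, and the target of an edge leaves \<open>\<Omega>\<close> together with its
  source. So a target is never processed later, and as it is smaller than all cells processed so far, it
  was not processed before: targets are not sources.\<close>

lemma bm_loop_invariant:
  assumes "bm_loop r C \<Omega> A"
  shows "(\<forall>\<omega>\<in>\<Omega>. \<omega> \<in> C \<and> 3 \<le> card \<omega>) \<and>
    (\<forall>\<sigma> \<tau>. (\<sigma>, \<tau>) \<in> A \<longrightarrow> \<sigma> \<in> C \<and> sb r \<sigma> \<noteq> {} \<and> \<tau> = \<sigma> - sb r \<sigma> \<and>
       \<tau> \<notin> \<Omega> \<and> \<tau> \<notin> Domain A \<and> (\<forall>\<omega>\<in>\<Omega>. card \<omega> \<le> card \<sigma>))"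
  using assms
proof (induction rule: bm_loop.induct)
  case start
  show ?case by auto
next
  case (step \<Omega> A \<sigma>)
  let ?\<tau> = "\<sigma> - sb r \<sigma>"
  show ?case
  proof (cases "sb r \<sigma> = {}")
    case True
    thus ?thesis using step by auto
  next
    case False
    have \<Omega>: "\<omega> \<in> C" "3 \<le> card \<omega>" if "\<omega> \<in> \<Omega>" for \<omega> using step.IH that by auto
    have old: "\<rho> \<in> C" "sb r \<rho> \<noteq> {}" "\<xi> = \<rho> - sb r \<rho>" "\<xi> \<notin> \<Omega>" "\<xi> \<notin> Domain A"
      "\<And>\<omega>. \<omega> \<in> \<Omega> \<Longrightarrow> card \<omega> \<le> card \<rho>" if "(\<rho>, \<xi>) \<in> A" for \<rho> \<xi>
      using step.IH that by simp_all
    have sub: "sb r \<sigma> \<subseteq> \<sigma>" by (auto simp: sb_def bridges_def)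
    have "3 \<le> card \<sigma>" using \<Omega>(2) step.hyps(2) by blast
    hence "finite \<sigma>" by (intro card_ge_0_finite) simp
    hence card: "card ?\<tau> < card \<sigma>" using sub False by (intro psubset_card_mono) auto
    have "?\<tau> \<notin> Domain A"
    proof
      assume "?\<tau> \<in> Domain A"
      then obtain \<xi> where "(?\<tau>, \<xi>) \<in> A" by blast
      thus False using old(6)[of ?\<tau> \<xi> \<sigma>] step.hyps(2) card by simp
    qed
    hence new: "?\<tau> \<notin> Domain (insert (\<sigma>, ?\<tau>) A)" using card by auto
    have "\<xi> \<notin> Domain (insert (\<sigma>, ?\<tau>) A)" if "(\<rho>, \<xi>) \<in> A" for \<rho> \<xi>
      using old(4,5)[OF that] step.hyps(2) by auto
    thus ?thesis using \<Omega> old new step.hyps(2,3) False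
      by (simp del: Domain_insert)
  qed
qed

lemma barile_macchia_edge:
  assumes "barile_macchia r C A" "(\<sigma>, \<tau>) \<in> A"
  shows "\<sigma> \<in> C" "sb r \<sigma> \<noteq> {}" "\<tau> = \<sigma> - sb r \<sigma>" "\<tau> \<notin> Domain A"
proof -
  obtain A\<^sub>0 where A: "bm_loop r C {} A\<^sub>0" "A = bm_prune r A\<^sub>0"
    using assms(1) by (auto simp: barile_macchia_def)
  have sub: "A \<subseteq> A\<^sub>0" using A(2) by (auto simp: bm_prune_def)
  hence *: "(\<sigma>, \<tau>) \<in> A\<^sub>0" using assms(2) by blast
  show "\<sigma> \<in> C" "sb r \<sigma> \<noteq> {}" "\<tau> = \<sigma> - sb r \<sigma>"
    using bm_loop_invariant[OF A(1)] * by simp_all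
  have "\<tau> \<notin> Domain A\<^sub>0" using bm_loop_invariant[OF A(1)] * by metis
  thus "\<tau> \<notin> Domain A" using sub by blast
qed

text \<open>Two sources of the same target arise from it by inserting different vertices, their smallest bridges.
  These are comparable, so the pruning step discards one of the two edges.\<close>

lemma barile_macchia_source_unique:
  assumes r: "linear_order_on S r" and C: "C \<subseteq> Pow S" and A: "barile_macchia r C A"
    and e: "(\<sigma>, \<tau>) \<in> A" "(\<sigma>', \<tau>) \<in> A"
  shows "\<sigma> = \<sigma>'"
proof (rule ccontr)
  assume ne: "\<sigma> \<noteq> \<sigma>'"
  have S: "\<sigma> \<subseteq> S" "\<sigma>' \<subseteq> S" using barile_macchia_edge(1)[OF A] e C by blast+
  obtain m where m: "sb r \<sigma> = {m}" "m \<in> \<sigma>"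
    using sb_cases[OF r S(1) barile_macchia_edge(2)[OF A e(1)]] by metis
  obtain m' where m': "sb r \<sigma>' = {m'}" "m' \<in> \<sigma>'"
    using sb_cases[OF r S(2) barile_macchia_edge(2)[OF A e(2)]] by metis
  have "\<tau> = \<sigma> - {m}" "\<tau> = \<sigma>' - {m'}"
    using barile_macchia_edge(3)[OF A] e m(1) m'(1) by metis+
  hence "m \<noteq> m'" using ne m(2) m'(2) by auto
  moreover have "total_on S r" using r by (simp add: linear_order_on_def)
  ultimately have "(m, m') \<in> r \<or> (m', m) \<in> r" using m(2) m'(2) S unfolding total_on_def by blast
  moreover obtain A\<^sub>0 where A\<^sub>0: "A = bm_prune r A\<^sub>0" using A by (auto simp: barile_macchia_def)
  have "(\<sigma>, \<tau>) \<in> A\<^sub>0" "(\<sigma>', \<tau>) \<in> A\<^sub>0" using e A\<^sub>0 by (auto simp: bm_prune_def)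
  hence "(m', m) \<notin> r" "(m, m') \<notin> r"
    using e A\<^sub>0 ne \<open>m \<noteq> m'\<close> m(1) m'(1) by (auto simp: bm_prune_def)
  ultimately show False by simp
qed

text \<open>Every edge lies in a single fibre of \<open>f\<close>, so conflicts between edges occur only within one run of the
  algorithm. For acyclicity, a vertex that can be removed without leaving the fibre also preserves the
  lcm; it is therefore a bridge, and not smaller than the smallest bridge.\<close>

theorem barile_macchia_union_matching:
  fixes S :: "'n::finite monomial set" and f :: "'n monomial set \<Rightarrow> 'p::order"
  assumes fin: "finite S" and f: "lcm_compatible S f"
    and ord: "\<And>p. linear_order_on S (ord p)"
    and hom: "\<And>\<sigma>. \<sigma> \<subseteq> S \<Longrightarrow> f (\<sigma> - sb (ord (f \<sigma>)) \<sigma>) = f \<sigma>"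
    and A: "\<And>p. barile_macchia (ord p) {\<sigma>. \<sigma> \<subseteq> S \<and> f \<sigma> = p} (A p)"
  shows "hom_acyclic_matching S f (\<Union>p. A p)"
proof -
  let ?U = "\<Union>p. A p"
  have edge: "\<sigma> \<subseteq> S \<and> f \<tau> = f \<sigma> \<and> (\<sigma>, \<tau>) \<in> A (f \<sigma>)" if e: "(\<sigma>, \<tau>) \<in> ?U" for \<sigma> \<tau>
  proof -
    obtain p where p: "(\<sigma>, \<tau>) \<in> A p" using e by auto
    have "\<sigma> \<subseteq> S" "f \<sigma> = p" "\<tau> = \<sigma> - sb (ord p) \<sigma>" using barile_macchia_edge[OF A p] by auto
    thus ?thesis using hom p by auto
  qed
  define key where "key \<sigma> = the_elem (sb (ord (f \<sigma>)) \<sigma>)" for \<sigma>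
  have key: "key \<sigma> \<in> \<sigma> \<and> \<tau> = \<sigma> - {key \<sigma>} \<and> (\<forall>x\<in>bridges \<sigma>. (key \<sigma>, x) \<in> ord (f \<sigma>))"
    if "(\<sigma>, \<tau>) \<in> ?U" for \<sigma> \<tau>
  proof -
    note e = edge[OF that]
    note bm = barile_macchia_edge[OF A conjunct2[OF conjunct2[OF e]]]
    obtain m where m: "sb (ord (f \<sigma>)) \<sigma> = {m}" "m \<in> \<sigma>" "\<And>x. x \<in> bridges \<sigma> \<Longrightarrow> (m, x) \<in> ord (f \<sigma>)"
      using sb_cases[OF ord conjunct1[OF e] bm(2)] by metis
    thus ?thesis using bm(3) by (simp add: key_def)
  qed
  have target_unique: "\<tau> = \<tau>'" if "(\<sigma>, \<tau>) \<in> ?U" "(\<sigma>, \<tau>') \<in> ?U" for \<sigma> \<tau> \<tau>'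
    using key[OF that(1)] key[OF that(2)] by simp
  have source_unique: "\<sigma> = \<sigma>'" if "(\<sigma>, \<tau>) \<in> ?U" "(\<sigma>', \<tau>) \<in> ?U" for \<sigma> \<sigma>' \<tau>
  proof (rule barile_macchia_source_unique[OF ord _ A])
    show "(\<sigma>, \<tau>) \<in> A (f \<tau>)" "(\<sigma>', \<tau>) \<in> A (f \<tau>)"
      using edge[OF that(1)] edge[OF that(2)] by simp_all
  qed auto
  have not_both: False if "(\<sigma>, \<tau>) \<in> ?U" "(\<tau>, \<rho>) \<in> ?U" for \<sigma> \<tau> \<rho>
  proof -
    have "(\<sigma>, \<tau>) \<in> A (f \<tau>)" "(\<tau>, \<rho>) \<in> A (f \<tau>)"
      using edge[OF that(1)] edge[OF that(2)] by simp_all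
    thus False using barile_macchia_edge(4)[OF A] by blast
  qed
  interpret matching S ?U
  proof
    show "finite S" by (rule fin)
    show "?U \<subseteq> cell_edges S"
    proof (rule subrelI)
      fix \<sigma> \<tau> assume e: "(\<sigma>, \<tau>) \<in> ?U"
      have "finite \<sigma>" using edge[OF e] fin finite_subset by blast
      hence "card \<sigma> = card \<tau> + 1" using key[OF e] by (metis Suc_eq_plus1 card_Suc_Diff1)
      thus "(\<sigma>, \<tau>) \<in> cell_edges S" using edge[OF e] key[OF e] by (auto simp: cell_edges_def)
    qed
    show "\<exists>\<^sub>\<le>\<^sub>1 e. e \<in> ?U \<and> (fst e = \<sigma> \<or> snd e = \<sigma>)" for \<sigma>
    proof (rule Uniq_I)
      fix e e' assume "e \<in> ?U \<and> (fst e = \<sigma> \<or> snd e = \<sigma>)" "e' \<in> ?U \<and> (fst e' = \<sigma> \<or> snd e' = \<sigma>)"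
      moreover obtain \<rho> \<tau> \<rho>' \<tau>' where "e = (\<rho>, \<tau>)" "e' = (\<rho>', \<tau>')" by (cases e, cases e')
      ultimately have "(\<rho>, \<tau>) \<in> ?U" "(\<rho>', \<tau>') \<in> ?U" "\<rho> = \<sigma> \<or> \<tau> = \<sigma>" "\<rho>' = \<sigma> \<or> \<tau>' = \<sigma>"
        and e: "e = (\<rho>, \<tau>)" "e' = (\<rho>', \<tau>')" by simp_all
      hence "\<rho> = \<rho>' \<and> \<tau> = \<tau>'" using target_unique source_unique not_both by metis
      thus "e' = e" using e by simp
    qed
  qed
  obtain g :: "'p \<Rightarrow> 'n \<Rightarrow> int" where g: "\<forall>\<sigma>\<subseteq>S. g (f \<sigma>) = expvec (lcm_mono \<sigma>)"
    using f unfolding lcm_compatible_def by blast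
  have "acyclic R"
  proof (rule acyclic_if_smallest_removed[OF ord])
    show "f \<tau> \<le> f \<sigma>" if "(\<sigma>, \<tau>) \<in> R" for \<sigma> \<tau>
      using that
    proof (cases rule: R_cases)
      case down
      thus ?thesis using f by (auto simp: lcm_compatible_def intro: mono_onD)
    next
      case up
      thus ?thesis using edge by simp
    qed
    show "(key \<sigma>, x) \<in> ord (f \<sigma>)" if e: "(\<sigma>, \<tau>) \<in> ?U" and x: "x \<in> \<sigma>" "f (\<sigma> - {x}) = f \<sigma>" for \<sigma> \<tau> x
    proof -
      have "\<sigma> \<subseteq> S" "\<sigma> - {x} \<subseteq> S" using edge[OF e] by auto
      hence "lcm_mono (\<sigma> - {x}) = lcm_mono \<sigma>" using g x(2) by (metis expvec_inject)
      thus ?thesis using key[OF e] x(1) by (simp add: bridges_def)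
    qed
  qed (use key in auto)
  thus ?thesis
    unfolding hom_acyclic_matching_def using edges matched_once edge by fastforce
qed

section \<open>Resolutions of monomial ideals\<close>

text \<open>The theorem of Batzies and Welker for the Taylor resolution. The grading enters through the
  lcm, which factors through it: matched cells have the same lcm.\<close>

theorem hom_acyclic_matching_resolution:
  fixes I :: "('n::finite, 'k::field) mpoly set" and f :: "'n monomial set \<Rightarrow> 'p::order"
  assumes I: "monomial_ideal I" and f: "lcm_compatible (mingens I) f"
    and A: "hom_acyclic_matching (mingens I) f A" and v: "linear_order_on (mingens I) v"
  shows "graded_free_resolution I (critical_cells (mingens I) A)
    (\<lambda>\<sigma>. expvec (lcm_mono \<sigma>)) (morse_differential (mingens I) v A)"
proof -
  interpret homogeneous_matching "mingens I" A v
  proof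
    show "finite (mingens I)" by (rule finite_mingens)
    show edges: "A \<subseteq> cell_edges (mingens I)"
      using A by (simp add: hom_acyclic_matching_def)
    show "\<exists>\<^sub>\<le>\<^sub>1 e. e \<in> A \<and> (fst e = \<sigma> \<or> snd e = \<sigma>)" for \<sigma>
      using A by (simp add: hom_acyclic_matching_def)
    show "acyclic (reverse_edges (mingens I) A)"
      using A by (simp add: hom_acyclic_matching_def)
    obtain g :: "'p \<Rightarrow> 'n \<Rightarrow> int" where g: "\<forall>\<sigma>\<subseteq>mingens I. g (f \<sigma>) = expvec (lcm_mono \<sigma>)"
      using f unfolding lcm_compatible_def by blast
    show "lcm_mono \<sigma> = lcm_mono \<tau>" if "(\<sigma>, \<tau>) \<in> A" for \<sigma> \<tau>
    proof -
      have "\<sigma> \<subseteq> mingens I" "\<tau> \<subseteq> mingens I" "f \<sigma> = f \<tau>"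
        using A edges that by (auto simp: hom_acyclic_matching_def cell_edges_def)
      thus ?thesis using g by (metis expvec_inject)
    qed
  qed (rule v)
  interpret module "(*) :: ('n, 'k) mpoly \<Rightarrow> _" by (rule module_mult)
  show ?thesis
  proof (rule resolution)
    show "subspace I" using I unfolding monomial_ideal_def by auto
    show "p \<in> I \<longleftrightarrow> (\<forall>a\<in>Poly_Mapping.keys p. below a \<noteq> {})" for p
      unfolding monomial_ideal_iff_keys[OF I] below_def by auto
  qed
qed

theorem theorem5p17:
  fixes I :: "('n::finite, 'k::field) mpoly set"
    and f :: "'n monomial set \<Rightarrow> 'p::order"
    and ord :: "'p \<Rightarrow> 'n monomial rel"
    and A :: "'p \<Rightarrow> 'n monomial set rel"
    and v :: "'n monomial rel"
  assumes "monomial_ideal I"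
    and "lcm_compatible (mingens I) f"
    and "\<And>p. linear_order_on (mingens I) (ord p)"
    and "\<And>p \<sigma>. \<sigma> \<subseteq> mingens I \<Longrightarrow> f \<sigma> = p \<Longrightarrow> f (\<sigma> - sb (ord p) \<sigma>) = f \<sigma>"
    and "\<And>p. barile_macchia (ord p) {\<sigma>. \<sigma> \<subseteq> mingens I \<and> f \<sigma> = p} (A p)"
    and "linear_order_on (mingens I) v"
  shows "hom_acyclic_matching (mingens I) f (\<Union>p. A p) \<and>
    graded_free_resolution I (critical_cells (mingens I) (\<Union>p. A p))
      (\<lambda>\<sigma>. expvec (lcm_mono \<sigma>))
      (morse_differential (mingens I) v (\<Union>p. A p))"
proof
  show matching: "hom_acyclic_matching (mingens I) f (\<Union>p. A p)"
    by (rule barile_macchia_union_matching[OF finite_mingens assms(2,3) _ assms(5)])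
      (use assms(4) in auto)
  show "graded_free_resolution I (critical_cells (mingens I) (\<Union>p. A p))
      (\<lambda>\<sigma>. expvec (lcm_mono \<sigma>)) (morse_differential (mingens I) v (\<Union>p. A p))"
    by (rule hom_acyclic_matching_resolution[OF assms(1,2) matching assms(6)])
qed

end
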